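(* Place $n$ chips on the vertex $v_0$ of the Sierpinski gasket graph $SG_m$ (with $m$ large enough depending on $n$, and no chips elsewhere) and stabilize. Let $T_n$ be the set of vertices that topple at least once. Then, as $n\to\infty$, $$\max_{u,v\in T_n} d(u,v)=\Theta\left(n^{1/D_f}\right),\qquad D_f=\frac{\log 3}{\log 2}.$$
   Context: Graphs. $SG_0$ is a triangle (complete graph on 3 vertices, all of them called corners: left, right, top). For $m\ge 1$, $SG_m$ is obtained from three copies of $SG_{m-1}$ (bottom-left, bottom-right, top) by identifying, for each pair of copies, one corner of one with one corner of the other in the usual Sierpinski gasket arrangement: right corner of bottom-left with left corner of bottom-right, top corner of bottom-left with left corner of top, top corner of bottom-right with right corner of top. The remaining three unidentified corners are the corners of $SG_m$. Every vertex of $SG_m$ other than its three corners has degree 4. The vertex $v_0$ of $SG_m$ is the vertex shared by the two bottom copies of $SG_{m-1}$. Sandpile dynamics. A configuration assigns a nonnegative integer number of chips to each vertex. A vertex $v$ with at least $\deg(v)$ chips is unstable and may topple, sending one chip to each neighbour. Topple unstable vertices until all are stable; the final configuration and the number of topplings of each vertex (the odometer) do not depend on the order. Setup. For a positive integer $n$, start with $n$ chips on $v_0$ and $0$ chips on all other vertices of $SG_m$, where $m$ is taken large enough (depending on $n$) that during stabilization chips stay in the bottom two level $m-1$ copies and never reach the top copy or the corners of $SG_m$; in particular the boundary/sink of $SG_m$ plays no role and $T_n$ does not depend on the choice of such $m$. $d$ is the graph metric of $SG_m$. *)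

theory Defs
  imports Complex_Main "HOL-Library.Landau_Symbols"
begin

text \<open>
  A vertex is given by its coordinates in the triangular lattice with respect to the two unit
  steps leaving the left corner: \<open>(1, 0)\<close> along the bottom side and \<open>(0, 1)\<close> along the left side.
  The left, right and top corner of the level \<open>m\<close> graph are \<open>(0, 0)\<close>, \<open>(2 ^ m, 0)\<close> and
  \<open>(0, 2 ^ m)\<close>. Two of the three copies that make up level \<open>m + 1\<close> are translates of
  level \<open>m\<close>, and the identification of corners is that of equal coordinates; that no other
  vertices get identified is the lemma \<open>sg_copies_glued\<close> below.
\<close>

type_synonym vertex = "nat \<times> nat"

definition shift :: "vertex \<Rightarrow> vertex \<Rightarrow> vertex" where
  "shift a v = (fst a + fst v, snd a + snd v)"

definition sg_corners :: "nat \<Rightarrow> vertex set" where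
  "sg_corners m = {(0, 0), (2 ^ m, 0), (0, 2 ^ m)}"

primrec sg_verts :: "nat \<Rightarrow> vertex set" where
  "sg_verts 0 = sg_corners 0"
| "sg_verts (Suc m) =
     sg_verts m \<union> shift (2 ^ m, 0) ` sg_verts m \<union> shift (0, 2 ^ m) ` sg_verts m"

text \<open>Edges are undirected: both orientations of an edge belong to the adjacency relation.\<close>

primrec sg_adj :: "nat \<Rightarrow> (vertex \<times> vertex) set" where
  "sg_adj 0 = {(u, v). u \<in> sg_corners 0 \<and> v \<in> sg_corners 0 \<and> u \<noteq> v}"
| "sg_adj (Suc m) =
     sg_adj m \<union> map_prod (shift (2 ^ m, 0)) (shift (2 ^ m, 0)) ` sg_adj m
              \<union> map_prod (shift (0, 2 ^ m)) (shift (0, 2 ^ m)) ` sg_adj m"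

definition sg_deg :: "nat \<Rightarrow> vertex \<Rightarrow> nat" where
  "sg_deg m v = card {u. (v, u) \<in> sg_adj m}"

definition sg_dist :: "nat \<Rightarrow> vertex \<Rightarrow> vertex \<Rightarrow> nat" where
  "sg_dist m u v = (LEAST k. (u, v) \<in> sg_adj m ^^ k)"

text \<open>The next two notions are meant for \<open>m \<ge> 1\<close> only.\<close>

definition sg_v0 :: "nat \<Rightarrow> vertex" where
  "sg_v0 m = (2 ^ (m - 1), 0)"

definition sg_top_copy :: "nat \<Rightarrow> vertex set" where
  "sg_top_copy m = shift (0, 2 ^ (m - 1)) ` sg_verts (m - 1)"

definition D_f :: real where
  "D_f = ln 3 / ln 2"

type_synonym config = "vertex \<Rightarrow> nat"

definition stable :: "nat \<Rightarrow> config \<Rightarrow> bool" where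
  "stable m \<eta> \<longleftrightarrow> (\<forall>v\<in>sg_verts m. \<eta> v < sg_deg m v)"

definition topple :: "nat \<Rightarrow> vertex \<Rightarrow> config \<Rightarrow> config" where
  "topple m v \<eta> =
     (\<lambda>u. if u = v then \<eta> u - sg_deg m v else if (v, u) \<in> sg_adj m then \<eta> u + 1 else \<eta> u)"

text \<open>
  \<open>toppling_run m \<eta> vs \<eta>'\<close>: toppling the vertices in the list \<open>vs\<close> one after the other, each of
  them being unstable at the moment it topples, leads from \<open>\<eta>\<close> to \<open>\<eta>'\<close>.
\<close>

inductive toppling_run :: "nat \<Rightarrow> config \<Rightarrow> vertex list \<Rightarrow> config \<Rightarrow> bool" for m where
  Nil: "toppling_run m \<eta> [] \<eta>"
| Cons: "v \<in> sg_verts m \<Longrightarrow> sg_deg m v \<le> \<eta> v \<Longrightarrow> toppling_run m (topple m v \<eta>) vs \<eta>' \<Longrightarrow>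
    toppling_run m \<eta> (v # vs) \<eta>'"

definition stabilization :: "nat \<Rightarrow> config \<Rightarrow> vertex list \<Rightarrow> config \<Rightarrow> bool" where
  "stabilization m \<eta> vs \<eta>' \<longleftrightarrow> toppling_run m \<eta> vs \<eta>' \<and> stable m \<eta>'"

definition point_config :: "nat \<Rightarrow> nat \<Rightarrow> config" where
  "point_config m n = (\<lambda>v. if v = sg_v0 m then n else 0)"

text \<open>
  Since the order of topplings may be chosen freely, the condition that no chip reaches the top
  copy or a corner is imposed on all configurations reachable by topplings.
\<close>

definition large_enough :: "nat \<Rightarrow> nat \<Rightarrow> bool" where
  "large_enough m n \<longleftrightarrow> m \<ge> 1 \<and>
     (\<exists>vs \<eta>. stabilization m (point_config m n) vs \<eta>) \<and>
     (\<forall>vs \<eta>. toppling_run m (point_config m n) vs \<eta> \<longrightarrow>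
        (\<forall>v \<in> sg_top_copy m \<union> sg_corners m. \<eta> v = 0))"

text \<open>
  The set \<open>T\<^sub>n\<close>, computed in the level \<open>m\<close> graph. All stabilizations of a configuration topple
  the same vertices, so the choice of \<open>vs\<close> is immaterial.
\<close>

definition toppled :: "nat \<Rightarrow> nat \<Rightarrow> vertex set" where
  "toppled m n = {v. \<exists>vs \<eta>. stabilization m (point_config m n) vs \<eta> \<and> v \<in> set vs}"

lemma sg_verts_bound: "v \<in> sg_verts m \<Longrightarrow> fst v + snd v \<le> 2 ^ m"
  by (induction m arbitrary: v) (fastforce simp: sg_corners_def shift_def)+

lemma sg_corners_subset: "sg_corners m \<subseteq> sg_verts m"
proof (induction m)
  case (Suc m)
  have "(2 ^ Suc m, 0) = shift (2 ^ m, 0) (2 ^ m, 0)" "(0, 2 ^ Suc m) = shift (0, 2 ^ m) (0, 2 ^ m)"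
    by (simp_all add: shift_def)
  with Suc show ?case by (auto simp: sg_corners_def)
qed (simp add: sg_corners_def)

lemma sg_copies_glued:
  "sg_verts m \<inter> shift (2 ^ m, 0) ` sg_verts m = {(2 ^ m, 0)}"
  "sg_verts m \<inter> shift (0, 2 ^ m) ` sg_verts m = {(0, 2 ^ m)}"
  "shift (2 ^ m, 0) ` sg_verts m \<inter> shift (0, 2 ^ m) ` sg_verts m = {(2 ^ m, 2 ^ m)}"
proof -
  have c: "(0, 0) \<in> sg_verts m" "(2 ^ m, 0) \<in> sg_verts m" "(0, 2 ^ m) \<in> sg_verts m"
    using sg_corners_subset[of m] by (auto simp: sg_corners_def)
  have s: "(2 ^ m, 0) = shift (2 ^ m, 0) (0, 0)" "(0, 2 ^ m) = shift (0, 2 ^ m) (0, 0)"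
    "(2 ^ m, 2 ^ m) = shift (2 ^ m, 0) (0, 2 ^ m)" "(2 ^ m, 2 ^ m) = shift (0, 2 ^ m) (2 ^ m, 0)"
    by (simp_all add: shift_def)
  have b: "fst v + snd v \<le> 2 ^ m" if "v \<in> sg_verts m" for v
    by (rule sg_verts_bound[OF that])
  have b1: "2 ^ m \<le> fst v \<and> fst v + snd v \<le> 2 * 2 ^ m" if "v \<in> shift (2 ^ m, 0) ` sg_verts m" for v
    using that b by (auto simp: shift_def)
  have b2: "2 ^ m \<le> snd v \<and> fst v + snd v \<le> 2 * 2 ^ m" if "v \<in> shift (0, 2 ^ m) ` sg_verts m" for v
    using that b by (fastforce simp: shift_def)
  have m: "(2 ^ m, 0) \<in> shift (2 ^ m, 0) ` sg_verts m" "(0, 2 ^ m) \<in> shift (0, 2 ^ m) ` sg_verts m"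
    "(2 ^ m, 2 ^ m) \<in> shift (2 ^ m, 0) ` sg_verts m" "(2 ^ m, 2 ^ m) \<in> shift (0, 2 ^ m) ` sg_verts m"
    using c s by (blast)+
  have "v = (2 ^ m, 0)" if "v \<in> sg_verts m" "v \<in> shift (2 ^ m, 0) ` sg_verts m" for v
    using b[OF that(1)] b1[OF that(2)] by (simp add: prod_eq_iff)
  with c m show "sg_verts m \<inter> shift (2 ^ m, 0) ` sg_verts m = {(2 ^ m, 0)}" by blast
  have "v = (0, 2 ^ m)" if "v \<in> sg_verts m" "v \<in> shift (0, 2 ^ m) ` sg_verts m" for v
    using b[OF that(1)] b2[OF that(2)] by (simp add: prod_eq_iff)
  with c m show "sg_verts m \<inter> shift (0, 2 ^ m) ` sg_verts m = {(0, 2 ^ m)}" by blast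
  have "v = (2 ^ m, 2 ^ m)"
    if "v \<in> shift (2 ^ m, 0) ` sg_verts m" "v \<in> shift (0, 2 ^ m) ` sg_verts m" for v
    using b1[OF that(1)] b2[OF that(2)] by (simp add: prod_eq_iff)
  with m show "shift (2 ^ m, 0) ` sg_verts m \<inter> shift (0, 2 ^ m) ` sg_verts m = {(2 ^ m, 2 ^ m)}"
    by blast
qed

lemma finite_sg_verts: "finite (sg_verts m)"
  by (induction m) (auto simp: sg_corners_def)

lemma sg_adj_subset: "sg_adj m \<subseteq> sg_verts m \<times> sg_verts m"
  by (induction m) auto

lemma sym_sg_adj: "sym (sg_adj m)"
proof (induction m)
  case 0
  show ?case by (auto simp: sym_def)
next
  case (Suc m)
  have "sym (map_prod f f ` sg_adj m)" for f :: "vertex \<Rightarrow> vertex"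
    using Suc by (force simp: sym_def)
  with Suc show ?case by (simp add: sym_Un)
qed

lemma irrefl_sg_adj: "irrefl (sg_adj m)"
  by (induction m) (auto simp: irrefl_def shift_def prod_eq_iff)

end

theory Submission
  imports Defs
begin

text \<open>
  Write \<open>u\<close> for the odometer. For the upper bound on the diameter, every edge at a toppled vertex
  still carries a chip sent along it, so at most \<open>2 n\<close> vertices topple. On the other hand, feed
  chips into a level \<open>k\<close> gasket at one corner. If the far corners are ever reached, then all
  \<open>3 ^ k\<close> lower-left vertices of the elementary triangles have toppled: this goes by induction on
  \<open>k\<close>, because the two far copies are entered through a single corner each: by symmetry, the
  vertex they share is not reached before the outer corners. Hence for \<open>3 ^ k > 2 n\<close> the
  topplings stay within the two level \<open>k\<close> gaskets at \<open>v\<^sub>0\<close>. All claims about reachability are made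
  with the least action principle: \<open>u\<close> is the least function that stabilizes the
  configuration, and stabilizing functions can be glued along the cut vertices.

  For the lower bound, all \<open>n\<close> chips end up within distance \<open>D + 1\<close> of \<open>v\<^sub>0\<close>, where \<open>D\<close> is the
  diameter, with a bounded number of chips at each of the \<open>O(D powr D_f)\<close> vertices there.
\<close>

section \<open>Geometry of the gasket graphs\<close>

definition nbrs :: "nat \<Rightarrow> vertex \<Rightarrow> vertex set" where
  "nbrs m v = {u. (v, u) \<in> sg_adj m}"

text \<open>The origin is left out because it serves as the entrance through which chips are fed
  into a gasket; these are the exits.\<close>

definition far_corners :: "nat \<Rightarrow> vertex set" where
  "far_corners k = {(2 ^ k, 0), (0, 2 ^ k)}"

lemma nbrs_subset: "nbrs m v \<subseteq> sg_verts m"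
  using sg_adj_subset by (auto simp: nbrs_def)

lemma finite_nbrs: "finite (nbrs m v)"
  using nbrs_subset finite_sg_verts by (rule finite_subset)

lemma nbrs_sym: "u \<in> nbrs m v \<longleftrightarrow> v \<in> nbrs m u"
  using symD[OF sym_sg_adj] unfolding nbrs_def by blast

lemma nbrs_dom: "u \<in> nbrs m v \<Longrightarrow> v \<in> sg_verts m"
  using nbrs_subset nbrs_sym by blast

lemma nbrs_irrefl: "v \<notin> nbrs m v"
  using irreflD[OF irrefl_sg_adj] unfolding nbrs_def by blast

lemma sg_deg_nbrs: "sg_deg m v = card (nbrs m v)"
  by (simp add: sg_deg_def nbrs_def)

lemma shift_eq_iff [simp]: "shift a u = shift a v \<longleftrightarrow> u = v"
  by (auto simp: shift_def prod_eq_iff)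

lemma shift_zero [simp]: "shift a (0, 0) = a"
  by (simp add: shift_def)

lemma sg_corner_verts [simp]:
  "(0, 0) \<in> sg_verts m" "(2 ^ m, 0) \<in> sg_verts m" "(0, 2 ^ m) \<in> sg_verts m"
  using sg_corners_subset[of m] by (auto simp: sg_corners_def)

lemma sg_adj_Suc_iff:
  "(x, y) \<in> sg_adj (Suc k) \<longleftrightarrow> (x, y) \<in> sg_adj k
     \<or> (\<exists>u v. x = shift (2 ^ k, 0) u \<and> y = shift (2 ^ k, 0) v \<and> (u, v) \<in> sg_adj k)
     \<or> (\<exists>u v. x = shift (0, 2 ^ k) u \<and> y = shift (0, 2 ^ k) v \<and> (u, v) \<in> sg_adj k)"
proof -
  have "(x, y) \<in> map_prod f f ` S \<longleftrightarrow> (\<exists>u v. x = f u \<and> y = f v \<and> (u, v) \<in> S)"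
    for f :: "vertex \<Rightarrow> vertex" and S
    by (simp only: image_iff Bex_def split_paired_Ex map_prod_simp prod.inject) blast
  then show ?thesis by simp
qed

lemma sg_verts_mono: "k \<le> j \<Longrightarrow> sg_verts k \<subseteq> sg_verts j"
  by (induction rule: dec_induct) auto

lemma sg_adj_mono: "k \<le> j \<Longrightarrow> sg_adj k \<subseteq> sg_adj j"
  by (induction rule: dec_induct) auto

lemma sg_adj_verts: "(u, v) \<in> sg_adj k \<Longrightarrow> u \<in> sg_verts k \<and> v \<in> sg_verts k"
  using sg_adj_subset by blast

lemma shift_right_in_left:
  assumes "v \<in> sg_verts k" "shift (2 ^ k, 0) v \<in> sg_verts k"
  shows "v = (0, 0)"
proof -
  have "shift (2 ^ k, 0) v \<in> {(2 ^ k, 0)}"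
    using assms sg_copies_glued(1)[of k] by blast
  then show ?thesis by (auto simp: shift_def prod_eq_iff)
qed

lemma shift_top_in_left:
  assumes "v \<in> sg_verts k" "shift (0, 2 ^ k) v \<in> sg_verts k"
  shows "v = (0, 0)"
proof -
  have "shift (0, 2 ^ k) v \<in> {(0, 2 ^ k)}"
    using assms sg_copies_glued(2)[of k] by blast
  then show ?thesis by (auto simp: shift_def prod_eq_iff)
qed

lemma shift_right_eq_top:
  assumes "u \<in> sg_verts k" "v \<in> sg_verts k" "shift (2 ^ k, 0) u = shift (0, 2 ^ k) v"
  shows "u = (0, 2 ^ k) \<and> v = (2 ^ k, 0)"
proof -
  have "shift (2 ^ k, 0) u \<in> {(2 ^ k, 2 ^ k)}"
    using assms sg_copies_glued(3)[of k] by blast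
  with assms(3) show ?thesis by (auto simp: shift_def prod_eq_iff)
qed

text \<open>The other two copies are attached to the left copy only at its far corners, so no other
  vertex gains neighbours when the level is raised.\<close>

lemma nbrs_Suc_left:
  assumes "v \<in> sg_verts k" "v \<notin> far_corners k"
  shows "nbrs (Suc k) v = nbrs k v"
proof -
  have "v \<noteq> shift (2 ^ k, 0) u" "v \<noteq> shift (0, 2 ^ k) u" if "u \<in> sg_verts k" for u
    using assms that shift_right_in_left[of u k] shift_top_in_left[of u k]
    by (auto simp: far_corners_def)
  then show ?thesis
    unfolding nbrs_def sg_adj_Suc_iff using sg_adj_verts by blast
qed

lemma nbrs_Suc_right:
  assumes "v \<in> sg_verts k" "v \<noteq> (0, 0)" "v \<noteq> (0, 2 ^ k)"
  shows "nbrs (Suc k) (shift (2 ^ k, 0) v) = shift (2 ^ k, 0) ` nbrs k v"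
proof -
  have "shift (2 ^ k, 0) v \<notin> sg_verts k"
    using assms shift_right_in_left by blast
  moreover have "shift (2 ^ k, 0) v \<noteq> shift (0, 2 ^ k) u" if "u \<in> sg_verts k" for u
    using assms that shift_right_eq_top by blast
  ultimately show ?thesis
    unfolding nbrs_def sg_adj_Suc_iff image_def
    by (intro Collect_cong) (metis mem_Collect_eq sg_adj_verts shift_eq_iff)
qed

lemma nbrs_Suc_top:
  assumes "v \<in> sg_verts k" "v \<noteq> (0, 0)" "v \<noteq> (2 ^ k, 0)"
  shows "nbrs (Suc k) (shift (0, 2 ^ k) v) = shift (0, 2 ^ k) ` nbrs k v"
proof -
  have "shift (0, 2 ^ k) v \<notin> sg_verts k"
    using assms shift_top_in_left by blast
  moreover have "shift (2 ^ k, 0) u \<noteq> shift (0, 2 ^ k) v" if "u \<in> sg_verts k" for u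
    using assms that shift_right_eq_top by blast
  ultimately show ?thesis
    unfolding nbrs_def sg_adj_Suc_iff image_def
    by (intro Collect_cong) (metis mem_Collect_eq sg_adj_verts shift_eq_iff)
qed

lemma junction_eq: "shift (2 ^ k, 0) (0, 2 ^ k) = (2 ^ k, 2 ^ k)"
  "shift (0, 2 ^ k) (2 ^ k, 0) = (2 ^ k, 2 ^ k)"
  by (auto simp: shift_def)

text \<open>The junction is a corner of both the right and the top copy. Its coordinate sum exceeds
  \<open>2 ^ k\<close>, so the left copy contributes no edge.\<close>

lemma nbrs_Suc_junction:
  "nbrs (Suc k) (2 ^ k, 2 ^ k) =
     shift (2 ^ k, 0) ` nbrs k (0, 2 ^ k) \<union> shift (0, 2 ^ k) ` nbrs k (2 ^ k, 0)"
proof -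
  have 0: "(2 ^ k, 2 ^ k) \<notin> sg_verts k"
    using sg_verts_bound[of "(2 ^ k, 2 ^ k)" k] by auto
  have 1: "(2 ^ k, 2 ^ k) = shift (2 ^ k, 0) u \<longleftrightarrow> u = (0, 2 ^ k)" for u
    by (cases u) (auto simp: shift_def)
  have 2: "(2 ^ k, 2 ^ k) = shift (0, 2 ^ k) u \<longleftrightarrow> u = (2 ^ k, 0)" for u
    by (cases u) (auto simp: shift_def)
  have 3: "(2 ^ k, 2 ^ k) \<noteq> u" if "(u, v) \<in> sg_adj k" for u v
    using 0 sg_adj_verts[OF that] by blast
  show ?thesis
    unfolding nbrs_def sg_adj_Suc_iff 1 2 image_def using 3 by blast
qed

section \<open>Paths and the graph distance\<close>

lemma relpow_map:
  assumes "\<And>x y. (x, y) \<in> R \<Longrightarrow> (f x, f y) \<in> S"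
  shows "(x, y) \<in> R ^^ d \<Longrightarrow> (f x, f y) \<in> S ^^ d"
proof (induction d arbitrary: y)
  case (Suc d)
  then obtain z where z: "(x, z) \<in> R ^^ d" "(z, y) \<in> R" by auto
  show ?case using Suc.IH[OF z(1)] assms[OF z(2)] by auto
qed simp

text \<open>The right and the top copy have their own origins at corners of the left copy, so a path
  crosses at most two copies and its length at most doubles per level.\<close>

lemma sg_path_from_origin:
  "v \<in> sg_verts k \<Longrightarrow> \<exists>d\<le>2 ^ k. ((0, 0), v) \<in> sg_adj k ^^ d"
proof (induction k arbitrary: v)
  case 0
  have "((0, 0), v) \<in> sg_adj 0 ^^ (if v = (0, 0) then 0 else 1)"
    using 0 by (auto simp: sg_corners_def)
  then show ?case by (intro exI[of _ "if v = (0, 0) then 0 else 1"] conjI) auto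
next
  case (Suc k)
  have mono: "(x, y) \<in> sg_adj (Suc k) ^^ d" if "(x, y) \<in> sg_adj k ^^ d" for x y d
    using relpow_map[OF _ that, of id] by (simp add: sg_adj_Suc_iff)
  have sh: "(shift a u, shift a v) \<in> sg_adj (Suc k) ^^ d"
    if a: "a \<in> {(2 ^ k, 0), (0, 2 ^ k)}" and "(u, v) \<in> sg_adj k ^^ d" for a u v d
  proof (rule relpow_map[OF _ that(2)])
    fix x y
    assume "(x, y) \<in> sg_adj k"
    then show "(shift a x, shift a y) \<in> sg_adj (Suc k)"
      using a unfolding sg_adj_Suc_iff by blast
  qed
  consider "v \<in> sg_verts k" | a u where "a \<in> {(2 ^ k, 0), (0, 2 ^ k)}" "u \<in> sg_verts k" "v = shift a u"
    using Suc.prems by auto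
  then show ?case
  proof cases
    case 1
    from Suc.IH[OF 1] obtain d where "d \<le> 2 ^ k" "((0, 0), v) \<in> sg_adj k ^^ d" by auto
    then show ?thesis using mono[of "(0, 0)" v d] by (intro exI[of _ d]) auto
  next
    case 2
    have "a \<in> sg_verts k" using 2 by auto
    from Suc.IH[OF this] obtain d where d: "d \<le> 2 ^ k" "((0, 0), a) \<in> sg_adj k ^^ d" by auto
    from Suc.IH[OF 2(2)] obtain e where e: "e \<le> 2 ^ k" "((0, 0), u) \<in> sg_adj k ^^ e" by auto
    have "(a, v) \<in> sg_adj (Suc k) ^^ e" using sh[OF 2(1) e(2)] 2(3) by simp
    with mono[OF d(2)] have "((0, 0), v) \<in> sg_adj (Suc k) ^^ (d + e)"
      by (auto simp: relpow_add)
    then show ?thesis using d(1) e(1) by (intro exI[of _ "d + e"]) auto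
  qed
qed

lemma relpow_sym: "sym R \<Longrightarrow> sym (R ^^ n)"
proof (induction n)
  case (Suc n)
  show ?case
  proof (rule symI)
    fix x y
    assume "(x, y) \<in> R ^^ Suc n"
    then obtain z where "(x, z) \<in> R ^^ n" "(z, y) \<in> R" by auto
    with Suc show "(y, x) \<in> R ^^ Suc n" by (meson relpow_Suc_I2 symD)
  qed
qed (auto simp: sym_def)

lemma sg_path:
  assumes "u \<in> sg_verts m" "v \<in> sg_verts m"
  shows "\<exists>d\<le>2 * 2 ^ m. (u, v) \<in> sg_adj m ^^ d"
proof -
  obtain d where d: "d \<le> 2 ^ m" "((0, 0), u) \<in> sg_adj m ^^ d"
    using sg_path_from_origin assms by blast
  obtain e where e: "e \<le> 2 ^ m" "((0, 0), v) \<in> sg_adj m ^^ e"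
    using sg_path_from_origin assms by blast
  have "(u, (0, 0)) \<in> sg_adj m ^^ d"
    using d(2) relpow_sym[OF sym_sg_adj] by (meson symE)
  with e have "(u, v) \<in> sg_adj m ^^ (d + e)" by (auto simp: relpow_add)
  with d e show ?thesis by (intro exI[of _ "d + e"]) auto
qed

lemma sg_dist_le: "(u, v) \<in> sg_adj m ^^ k \<Longrightarrow> sg_dist m u v \<le> k"
  unfolding sg_dist_def by (rule Least_le)

text \<open>Connectivity guarantees that the \<open>LEAST\<close> in \<open>sg_dist\<close> is
  attained.\<close>

lemma sg_dist_path:
  assumes "u \<in> sg_verts m" "v \<in> sg_verts m"
  shows "(u, v) \<in> sg_adj m ^^ sg_dist m u v"
  unfolding sg_dist_def using sg_path[OF assms] by (auto intro: LeastI)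

lemma sg_dist_bound: "u \<in> sg_verts m \<Longrightarrow> v \<in> sg_verts m \<Longrightarrow> sg_dist m u v \<le> 2 * 2 ^ m"
  using sg_path sg_dist_le le_trans by blast

section \<open>Degrees, coordinates and vertex counts\<close>

lemma sg_adj_total:
  "v \<in> sg_verts m \<Longrightarrow> \<exists>u. (v, u) \<in> sg_adj m"
proof (induction m arbitrary: v)
  case 0
  have "(v, if v = (0, 0) then (1, 0) else (0, 0)) \<in> sg_adj 0"
    using 0 by (auto simp: sg_corners_def)
  then show ?case by blast
next
  case (Suc m)
  from Suc.prems consider "v \<in> sg_verts m"
    | w where "w \<in> sg_verts m" "v = shift (2 ^ m, 0) w"
    | w where "w \<in> sg_verts m" "v = shift (0, 2 ^ m) w"
    by auto
  then show ?case
  proof cases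
    case 1
    from Suc.IH[OF 1] show ?thesis unfolding sg_adj_Suc_iff by blast
  next
    case 2
    from Suc.IH[OF 2(1)] obtain u where "(w, u) \<in> sg_adj m" ..
    then show ?thesis unfolding sg_adj_Suc_iff 2(2)
      by (intro exI[of _ "shift (2 ^ m, 0) u"]) blast
  next
    case 3
    from Suc.IH[OF 3(1)] obtain u where "(w, u) \<in> sg_adj m" ..
    then show ?thesis unfolding sg_adj_Suc_iff 3(2)
      by (intro exI[of _ "shift (0, 2 ^ m) u"]) blast
  qed
qed

lemma sg_deg_pos: "v \<in> sg_verts m \<Longrightarrow> 0 < sg_deg m v"
  using sg_adj_total[of v m] finite_nbrs[of m v]
  unfolding sg_deg_nbrs card_gt_0_iff nbrs_def by blast

text \<open>Both coordinates and their sum are 1-Lipschitz for the graph distance. This later turns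
  distance bounds into membership in small copies.\<close>

lemma sg_adj_step:
  "(x, y) \<in> sg_adj m \<Longrightarrow> fst y \<le> fst x + 1 \<and> snd y \<le> snd x + 1
     \<and> fst x \<le> fst y + 1 \<and> snd x \<le> snd y + 1 \<and> fst y + snd y \<le> fst x + snd x + 1"
proof (induction m arbitrary: x y)
  case 0
  then show ?case by (auto simp: sg_corners_def)
next
  case (Suc m)
  from Suc.prems consider "(x, y) \<in> sg_adj m"
    | a u v where "x = shift a u" "y = shift a v" "(u, v) \<in> sg_adj m"
    unfolding sg_adj_Suc_iff by blast
  then show ?case
  proof cases
    case 1
    then show ?thesis by (rule Suc.IH)
  next
    case 2
    from Suc.IH[OF 2(3)] show ?thesis by (simp add: 2 shift_def)
  qed
qed

text \<open>All neighbours lie in the 3 by 3 box of lattice points around the vertex. The bound is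
  cruder than 4, but only boundedness matters.\<close>

lemma sg_deg_le: "sg_deg m v \<le> 9"
proof -
  have "nbrs m v \<subseteq> {fst v - 1..fst v + 1} \<times> {snd v - 1..snd v + 1}"
  proof
    fix u
    assume "u \<in> nbrs m v"
    then have "(v, u) \<in> sg_adj m" by (simp add: nbrs_def)
    from sg_adj_step[OF this] show "u \<in> {fst v - 1..fst v + 1} \<times> {snd v - 1..snd v + 1}"
      by (auto simp: mem_Times_iff)
  qed
  then have "card (nbrs m v) \<le> card ({fst v - 1..fst v + 1} \<times> {snd v - 1..snd v + 1})"
    by (rule card_mono[rotated]) simp
  also have "\<dots> \<le> 3 * 3"
    unfolding card_cartesian_product by (rule mult_le_mono) auto
  finally show ?thesis by (simp add: sg_deg_nbrs)
qed

text \<open>For paths starting at \<open>sg_v0 m\<close>, the first inequality limits the extent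
  into the left bottom copy, the second the extent into the right one.\<close>

lemma sg_path_step:
  "(x, y) \<in> sg_adj m ^^ d \<Longrightarrow> fst x \<le> fst y + d \<and> fst y + snd y \<le> fst x + snd x + d"
proof (induction d arbitrary: y)
  case (Suc d)
  then obtain z where "(x, z) \<in> sg_adj m ^^ d" "(z, y) \<in> sg_adj m" by auto
  with Suc.IH[of z] sg_adj_step[of z y m] show ?case by auto
qed auto

lemma card_sg_verts_le: "card (sg_verts m) \<le> 3 * 3 ^ m"
proof (induction m)
  case 0
  show ?case using card_length[of "[(0, 0), (1, 0), (0, 1) :: vertex]"]
    by (simp add: sg_corners_def)
next
  case (Suc m)
  have "card (sg_verts (Suc m)) \<le> card (sg_verts m) + card (shift (2 ^ m, 0) ` sg_verts m)
      + card (shift (0, 2 ^ m) ` sg_verts m)"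
    by (simp, meson add_le_mono card_Un_le le_trans order_refl)
  also have "\<dots> \<le> 3 * card (sg_verts m)"
    using card_image_le[OF finite_sg_verts, of "shift (2 ^ m, 0)" m]
      card_image_le[OF finite_sg_verts, of "shift (0, 2 ^ m)" m] by linarith
  finally show ?case using Suc by simp
qed

text \<open>A right or top copy added at a level of at least \<open>k\<close> has coordinate sums of
  at least \<open>2 ^ k\<close>. It meets the region in question at most in its own origin, which
  already belongs to the left copy.\<close>

lemma sg_verts_low:
  "v \<in> sg_verts m \<Longrightarrow> k \<le> m \<Longrightarrow> fst v + snd v \<le> 2 ^ k \<Longrightarrow> v \<in> sg_verts k"
proof (induction m arbitrary: v)
  case (Suc m)
  show ?case
  proof (cases "k = Suc m")
    case False
    with Suc.prems have k: "k \<le> m" by simp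
    have "v \<in> sg_verts m"
    proof (rule ccontr)
      assume n: "v \<notin> sg_verts m"
      with Suc.prems obtain a u where a: "a \<in> {(2 ^ m, 0), (0, 2 ^ m)}" "v = shift a u"
        by auto
      have le: "(2::nat) ^ k \<le> 2 ^ m" using k by simp
      have "u = (0, 0)"
        using a(1)
      proof (elim insertE emptyE)
        assume "a = (2 ^ m, 0)"
        then have "2 ^ m + fst u + snd u \<le> 2 ^ k"
          using a(2) Suc.prems(3) by (simp add: shift_def)
        with le have "fst u = 0" "snd u = 0" by linarith+
        then show ?thesis by (simp add: prod_eq_iff)
      next
        assume "a = (0, 2 ^ m)"
        then have "2 ^ m + fst u + snd u \<le> 2 ^ k"
          using a(2) Suc.prems(3) by (simp add: shift_def)
        with le have "fst u = 0" "snd u = 0" by linarith+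
        then show ?thesis by (simp add: prod_eq_iff)
      qed
      with a n show False by auto
    qed
    with Suc k show ?thesis by blast
  qed (use Suc.prems in simp)
qed auto

section \<open>Lower-left vertices of the elementary triangles\<close>

primrec lower_left :: "nat \<Rightarrow> vertex set" where
  "lower_left 0 = {(0, 0)}"
| "lower_left (Suc k) =
     lower_left k \<union> shift (2 ^ k, 0) ` lower_left k \<union> shift (0, 2 ^ k) ` lower_left k"

text \<open>Strictness excludes the far corners, at which copies are glued; hence the three copies
  of \<open>lower_left k\<close> are disjoint and can be counted exactly.\<close>

lemma lower_left_bound: "v \<in> lower_left k \<Longrightarrow> fst v + snd v < 2 ^ k"
  by (induction k arbitrary: v) (fastforce simp: shift_def)+

lemma lower_left_subset: "lower_left k \<subseteq> sg_verts k"
  by (induction k) (auto simp: sg_corners_def)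

lemma card_lower_left: "card (lower_left k) = 3 ^ k"
proof (induction k)
  case (Suc k)
  have fin: "finite (lower_left k)"
    using lower_left_subset finite_sg_verts by (rule finite_subset)
  have "lower_left k \<inter> shift (2 ^ k, 0) ` lower_left k = {}"
    "(lower_left k \<union> shift (2 ^ k, 0) ` lower_left k) \<inter> shift (0, 2 ^ k) ` lower_left k = {}"
    by (fastforce simp: shift_def dest!: lower_left_bound)+
  then show ?case
    using Suc fin by (simp add: card_Un_disjoint card_image inj_on_def)
qed simp

section \<open>Reflections of the gasket\<close>

text \<open>The reflection in the vertical axis, exchanging the left and right corners. By
  \<open>sg_verts_bound\<close> the subtraction is never truncated on
  \<open>sg_verts k\<close>.\<close>

definition mirror :: "nat \<Rightarrow> vertex \<Rightarrow> vertex" where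
  "mirror k v = (2 ^ k - fst v - snd v, snd v)"

lemma mirror_mirror: "v \<in> sg_verts k \<Longrightarrow> mirror k (mirror k v) = v"
  using sg_verts_bound[of v k] by (auto simp: mirror_def prod_eq_iff)

lemma mirror_Suc_shift:
  assumes "v \<in> sg_verts k"
  shows "mirror (Suc k) v = shift (2 ^ k, 0) (mirror k v)"
    "mirror (Suc k) (shift (2 ^ k, 0) v) = mirror k v"
    "mirror (Suc k) (shift (0, 2 ^ k) v) = shift (0, 2 ^ k) (mirror k v)"
  using sg_verts_bound[OF assms] by (auto simp: mirror_def shift_def)

lemma mirror_verts: "v \<in> sg_verts k \<Longrightarrow> mirror k v \<in> sg_verts k"
proof (induction k arbitrary: v)
  case 0
  then show ?case by (auto simp: sg_corners_def mirror_def)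
next
  case (Suc k)
  from Suc.prems consider "v \<in> sg_verts k"
    | w where "w \<in> sg_verts k" "v = shift (2 ^ k, 0) w"
    | w where "w \<in> sg_verts k" "v = shift (0, 2 ^ k) w"
    by auto
  then show ?case by cases (simp_all add: mirror_Suc_shift Suc.IH)
qed

lemma mirror_adj: "(u, v) \<in> sg_adj k \<Longrightarrow> (mirror k u, mirror k v) \<in> sg_adj k"
proof (induction k arbitrary: u v)
  case 0
  then show ?case by (auto simp: sg_corners_def mirror_def)
next
  case (Suc k)
  from Suc.prems consider "(u, v) \<in> sg_adj k"
    | x y where "(x, y) \<in> sg_adj k" "u = shift (2 ^ k, 0) x" "v = shift (2 ^ k, 0) y"
    | x y where "(x, y) \<in> sg_adj k" "u = shift (0, 2 ^ k) x" "v = shift (0, 2 ^ k) y"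
    unfolding sg_adj_Suc_iff by blast
  then show ?case
  proof cases
    case 1
    with Suc.IH[OF 1] show ?thesis
      unfolding sg_adj_Suc_iff by (simp only: mirror_Suc_shift sg_adj_verts) blast
  next
    case 2
    with Suc.IH[OF 2(1)] show ?thesis
      unfolding sg_adj_Suc_iff using sg_adj_verts[OF 2(1)] by (simp only: mirror_Suc_shift) blast
  next
    case 3
    with Suc.IH[OF 3(1)] show ?thesis
      unfolding sg_adj_Suc_iff using sg_adj_verts[OF 3(1)] by (simp only: mirror_Suc_shift) blast
  qed
qed

text \<open>\<open>prod.swap\<close> is the reflection that fixes the origin and exchanges the right
  and the top copy.\<close>

lemma swap_shift: "prod.swap (shift (a, b) u) = shift (b, a) (prod.swap u)"
  by (simp add: shift_def)

lemma swap_verts: "v \<in> sg_verts k \<Longrightarrow> prod.swap v \<in> sg_verts k"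
proof (induction k arbitrary: v)
  case 0
  then show ?case by (auto simp: sg_corners_def)
next
  case (Suc k)
  from Suc.prems consider "v \<in> sg_verts k"
    | w where "w \<in> sg_verts k" "v = shift (2 ^ k, 0) w"
    | w where "w \<in> sg_verts k" "v = shift (0, 2 ^ k) w"
    by auto
  then show ?case by cases (simp_all add: swap_shift Suc.IH)
qed

lemma swap_adj: "(u, v) \<in> sg_adj k \<Longrightarrow> (prod.swap u, prod.swap v) \<in> sg_adj k"
proof (induction k arbitrary: u v)
  case 0
  then show ?case by (auto simp: sg_corners_def)
next
  case (Suc k)
  from Suc.prems consider "(u, v) \<in> sg_adj k"
    | x y where "(x, y) \<in> sg_adj k" "u = shift (2 ^ k, 0) x" "v = shift (2 ^ k, 0) y"
    | x y where "(x, y) \<in> sg_adj k" "u = shift (0, 2 ^ k) x" "v = shift (0, 2 ^ k) y"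
    unfolding sg_adj_Suc_iff by blast
  then show ?case
    using Suc.IH unfolding sg_adj_Suc_iff by cases (simp only: swap_shift, blast)+
qed

section \<open>Toppling runs and the least action principle\<close>

lemma topple_nbrs:
  "topple m v \<eta> u = (if u = v then \<eta> u - sg_deg m v else if u \<in> nbrs m v then \<eta> u + 1 else \<eta> u)"
  by (simp add: topple_def nbrs_def)

lemma toppling_run_append:
  "toppling_run m \<eta> vs \<eta>' \<Longrightarrow> toppling_run m \<eta>' ws \<eta>'' \<Longrightarrow> toppling_run m \<eta> (vs @ ws) \<eta>''"
  by (induction rule: toppling_run.induct) (auto intro: toppling_run.intros)

lemma toppling_run_verts: "toppling_run m \<eta> vs \<eta>' \<Longrightarrow> set vs \<subseteq> sg_verts m"
  by (induction rule: toppling_run.induct) auto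

text \<open>\<open>count_list vs\<close> is the odometer of the run. Chips sent out stand on the
  left and chips received on the right, which avoids subtraction of naturals.\<close>

lemma toppling_run_balance:
  "toppling_run m \<eta> vs \<eta>' \<Longrightarrow>
     \<eta>' x + sg_deg m x * count_list vs x = \<eta> x + (\<Sum>y\<in>nbrs m x. count_list vs y)"
proof (induction rule: toppling_run.induct)
  case (Cons v \<eta> vs \<eta>')
  have 1: "(\<Sum>y\<in>nbrs m x. count_list (v # vs) y)
      = (\<Sum>y\<in>nbrs m x. count_list vs y) + (if v \<in> nbrs m x then 1 else 0)"
  proof -
    have "(\<Sum>y\<in>nbrs m x. count_list (v # vs) y)
        = (\<Sum>y\<in>nbrs m x. count_list vs y + (if v = y then 1 else 0))"
      by (intro sum.cong) auto
    then show ?thesis by (simp add: sum.distrib finite_nbrs)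
  qed
  show ?case
  proof (cases "x = v")
    case True
    then show ?thesis
      using Cons.IH Cons.hyps(2) nbrs_irrefl[of v m] unfolding 1 topple_nbrs by (simp add: algebra_simps)
  next
    case False
    then show ?thesis
      using Cons.IH nbrs_sym[of v m x] unfolding 1 topple_nbrs by (auto split: if_splits)
  qed
qed simp

lemma topple_total:
  assumes "v \<in> sg_verts m" "sg_deg m v \<le> \<eta> v"
  shows "(\<Sum>u\<in>sg_verts m. topple m v \<eta> u) = (\<Sum>u\<in>sg_verts m. \<eta> u)"
proof -
  have "(\<Sum>u\<in>sg_verts m. topple m v \<eta> u + (if u = v then sg_deg m v else 0))
      = (\<Sum>u\<in>sg_verts m. \<eta> u + (if u \<in> nbrs m v then 1 else 0))"
    using assms nbrs_irrefl[of v m] by (intro sum.cong) (auto simp: topple_nbrs)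
  moreover have "(\<Sum>u\<in>sg_verts m. if u \<in> nbrs m v then 1 else 0) = sg_deg m v"
    using nbrs_subset[of m v] finite_sg_verts[of m]
    by (simp add: sum.If_cases sg_deg_nbrs inf_absorb2)
  ultimately show ?thesis
    using assms finite_sg_verts[of m] by (simp add: sum.distrib)
qed

lemma toppling_run_total:
  "toppling_run m \<eta> vs \<eta>' \<Longrightarrow> (\<Sum>u\<in>sg_verts m. \<eta>' u) = (\<Sum>u\<in>sg_verts m. \<eta> u)"
  by (induction rule: toppling_run.induct) (simp_all add: topple_total)

section \<open>The least action principle\<close>

text \<open>Topplings are counted formally: they need not be legal, and the resulting numbers of
  chips may be negative. The condition that fewer than \<open>sg_deg m x\<close> chips remain is
  rearranged to avoid subtraction.\<close>

definition stabilizing :: "nat \<Rightarrow> config \<Rightarrow> (vertex \<Rightarrow> nat) \<Rightarrow> bool" where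
  "stabilizing m \<eta> f \<longleftrightarrow>
     (\<forall>x\<in>sg_verts m. \<eta> x + (\<Sum>y\<in>nbrs m x. f y) < sg_deg m x * (f x + 1))"

text \<open>If the first vertex \<open>v\<close> of the run had \<open>f v = 0\<close>, its chips
  would violate \<open>stabilizing\<close>. So \<open>f\<close> can be lowered by one at
  \<open>v\<close>, and the result stabilizes the configuration after that toppling.\<close>

lemma least_action:
  "toppling_run m \<eta> vs \<eta>' \<Longrightarrow> stabilizing m \<eta> f \<Longrightarrow> count_list vs x \<le> f x"
proof (induction arbitrary: f rule: toppling_run.induct)
  case (Cons v \<eta> vs \<eta>')
  let ?f = "f(v := f v - 1)"
  have pos: "0 < f v"
    using Cons.prems Cons.hyps(1,2) by (force simp: stabilizing_def intro: gr0I)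
  have "topple m v \<eta> x + (\<Sum>y\<in>nbrs m x. ?f y) < sg_deg m x * (?f x + 1)"
    if x: "x \<in> sg_verts m" for x
  proof -
    have "\<eta> x + (\<Sum>y\<in>nbrs m x. f y) < sg_deg m x * (f x + 1)"
      using Cons.prems x by (auto simp: stabilizing_def)
    moreover have "(\<Sum>y\<in>nbrs m x. f y) = (\<Sum>y\<in>nbrs m x. ?f y) + (if v \<in> nbrs m x then 1 else 0)"
    proof -
      have "(\<Sum>y\<in>nbrs m x. f y) = (\<Sum>y\<in>nbrs m x. ?f y + (if v = y then 1 else 0))"
        using pos by (intro sum.cong) auto
      then show ?thesis by (simp add: sum.distrib finite_nbrs)
    qed
    ultimately show ?thesis
      using pos Cons.hyps(2) nbrs_irrefl[of v m] nbrs_sym[of v m x]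
      by (cases "x = v") (auto simp: topple_nbrs algebra_simps split: if_splits)
  qed
  then have "stabilizing m (topple m v \<eta>) ?f" by (simp add: stabilizing_def)
  from Cons.IH[OF this] show ?case using pos by (auto split: if_splits)
qed simp

lemma stabilization_stabilizing:
  assumes "stabilization m \<eta> vs \<eta>'"
  shows "stabilizing m \<eta> (count_list vs)"
  unfolding stabilizing_def
proof
  fix x
  assume x: "x \<in> sg_verts m"
  have "\<eta>' x + sg_deg m x * count_list vs x = \<eta> x + (\<Sum>y\<in>nbrs m x. count_list vs y)"
    using assms toppling_run_balance by (auto simp: stabilization_def)
  moreover have "\<eta>' x < sg_deg m x" using assms x by (auto simp: stabilization_def stable_def)
  ultimately show "\<eta> x + (\<Sum>y\<in>nbrs m x. count_list vs y) < sg_deg m x * (count_list vs x + 1)"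
    by (simp add: algebra_simps)
qed

text \<open>
  \<open>L\<close> orients every edge at a toppled vertex towards the endpoint that toppled last. That endpoint
  has sent a chip along the edge after the last toppling of the other endpoint, where the chip
  still lies.
\<close>

definition edge_chips :: "nat \<Rightarrow> config \<Rightarrow> vertex set \<Rightarrow> (vertex \<times> vertex) set \<Rightarrow> bool" where
  "edge_chips m \<eta> T L \<longleftrightarrow> L \<subseteq> sg_adj m \<and> (\<forall>x. card {y. (x, y) \<in> L} \<le> \<eta> x)
     \<and> (\<forall>v\<in>T. \<forall>y\<in>nbrs m v. (v, y) \<in> L \<or> (y, v) \<in> L)"

lemma edge_chips_run:
  "toppling_run m \<eta> vs \<eta>' \<Longrightarrow> edge_chips m \<eta> T L \<Longrightarrow> \<exists>L'. edge_chips m \<eta>' (T \<union> set vs) L'"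
proof (induction arbitrary: T L rule: toppling_run.induct)
  case (Cons v \<eta> vs \<eta>')
  \<comment> \<open>A pair \<open>(x, y)\<close> stands for a chip at \<open>x\<close> received from
    \<open>y\<close>. Toppling \<open>v\<close> gives up the chips recorded at \<open>v\<close> and
    records a new one at each neighbour.\<close>
  let ?L = "(L - {v} \<times> UNIV) \<union> nbrs m v \<times> {v}"
  have L: "L \<subseteq> sg_adj m" "\<And>x. card {y. (x, y) \<in> L} \<le> \<eta> x"
    "\<And>v y. v \<in> T \<Longrightarrow> y \<in> nbrs m v \<Longrightarrow> (v, y) \<in> L \<or> (y, v) \<in> L"
    using Cons.prems by (auto simp: edge_chips_def)
  have adj: "(x, v) \<in> sg_adj m" if "x \<in> nbrs m v" for x
    using that nbrs_sym[of x m v] by (simp add: nbrs_def)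
  have "card {y. (x, y) \<in> ?L} \<le> topple m v \<eta> x" for x
  proof (cases "x = v")
    case True
    then show ?thesis using nbrs_irrefl[of v m] by simp
  next
    case False
    have fin: "finite {y. (x, y) \<in> L}"
      by (rule finite_subset[OF _ finite_nbrs[of m x]]) (use L(1) in \<open>auto simp: nbrs_def\<close>)
    show ?thesis
    proof (cases "x \<in> nbrs m v")
      case True
      with False have "{y. (x, y) \<in> ?L} = insert v {y. (x, y) \<in> L}" by auto
      then show ?thesis
        using L(2)[of x] False True card_insert_le_m1[of "\<eta> x + 1" "{y. (x, y) \<in> L}" v]
        by (simp add: topple_nbrs)
    next
      case nn: False
      with False have "{y. (x, y) \<in> ?L} = {y. (x, y) \<in> L}" by auto
      then show ?thesis using L(2)[of x] False nn by (simp add: topple_nbrs)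
    qed
  qed
  moreover have "(w, y) \<in> ?L \<or> (y, w) \<in> ?L" if "w \<in> insert v T" "y \<in> nbrs m w" for w y
  proof (cases "w = v \<or> y = v")
    case True
    then show ?thesis using that nbrs_sym[of y m w] by auto
  next
    case False
    then show ?thesis using that L(3)[of w y] by auto
  qed
  moreover have "?L \<subseteq> sg_adj m" using L(1) adj by auto
  ultimately have "edge_chips m (topple m v \<eta>) (insert v T) ?L"
    unfolding edge_chips_def by blast
  from Cons.IH[OF this] show ?case by simp
qed auto

text \<open>Every toppled vertex has a neighbour and is therefore an endpoint of a pair in
  \<open>L\<close>. Distinct pairs stand for distinct chips, and each pair has two
  endpoints.\<close>

lemma card_toppled_le:
  assumes run: "toppling_run m \<eta> vs \<eta>'"
  shows "card (set vs) \<le> 2 * (\<Sum>u\<in>sg_verts m. \<eta> u)"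
proof -
  have "edge_chips m \<eta> {} {}" by (simp add: edge_chips_def)
  from edge_chips_run[OF run this] obtain L where "edge_chips m \<eta>' (set vs) L" by auto
  then have L: "L \<subseteq> sg_adj m" "\<And>x. card {y. (x, y) \<in> L} \<le> \<eta>' x"
    "\<And>v y. v \<in> set vs \<Longrightarrow> y \<in> nbrs m v \<Longrightarrow> (v, y) \<in> L \<or> (y, v) \<in> L"
    by (auto simp: edge_chips_def)
  have finL: "finite L"
    using L(1) sg_adj_subset finite_sg_verts by (meson finite_SigmaI finite_subset)
  have "set vs \<subseteq> fst ` L \<union> snd ` L"
  proof
    fix v
    assume v: "v \<in> set vs"
    then obtain y where "y \<in> nbrs m v"
      using toppling_run_verts[OF run] sg_adj_total[of v m] by (auto simp: nbrs_def)
    from L(3)[OF v this] show "v \<in> fst ` L \<union> snd ` L" by force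
  qed
  then have "card (set vs) \<le> card (fst ` L \<union> snd ` L)" by (rule card_mono[rotated]) (simp add: finL)
  also have "\<dots> \<le> card (fst ` L) + card (snd ` L)" by (rule card_Un_le)
  also have "\<dots> \<le> 2 * card L"
    using card_image_le[OF finL, of fst] card_image_le[OF finL, of snd] by simp
  also have "card L \<le> (\<Sum>x\<in>sg_verts m. \<eta>' x)"
  proof -
    have "L = Sigma (sg_verts m) (\<lambda>x. {y. (x, y) \<in> L})"
      using subset_trans[OF L(1) sg_adj_subset] by auto
    moreover have "finite {y. (x, y) \<in> L}" for x
      by (rule finite_subset[OF _ finite_imageI[OF finL, of snd]]) force
    ultimately have "card L = (\<Sum>x\<in>sg_verts m. card {y. (x, y) \<in> L})"
      using card_SigmaI[OF finite_sg_verts] by metis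
    then show ?thesis using L(2) by (simp add: sum_mono)
  qed
  finally show ?thesis using toppling_run_total[OF run] by simp
qed

section \<open>Existence of stabilizations\<close>

text \<open>Each toppling of \<open>y\<close> sends a chip to \<open>x\<close>, which can keep no
  more than the total and passes on at most 9 chips per toppling of its own.\<close>

lemma count_growth:
  assumes run: "toppling_run m \<eta> vs \<eta>'" and y: "y \<in> nbrs m x"
  shows "count_list vs y \<le> (\<Sum>u\<in>sg_verts m. \<eta> u) + 9 * count_list vs x"
proof -
  have x: "x \<in> sg_verts m" using y nbrs_dom by blast
  have "count_list vs y \<le> (\<Sum>y\<in>nbrs m x. count_list vs y)"
    using y finite_nbrs by (intro member_le_sum) auto
  also have "\<dots> \<le> \<eta>' x + sg_deg m x * count_list vs x"
    using toppling_run_balance[OF run, of x] by simp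
  also have "\<eta>' x \<le> (\<Sum>u\<in>sg_verts m. \<eta>' u)"
    using x finite_sg_verts by (intro member_le_sum) auto
  also have "\<dots> = (\<Sum>u\<in>sg_verts m. \<eta> u)" by (rule toppling_run_total[OF run])
  also have "sg_deg m x * count_list vs x \<le> 9 * count_list vs x"
    using sg_deg_le by (rule mult_right_mono) simp
  finally show ?thesis by simp
qed

text \<open>No chip is ever lost, so termination comes from a vertex \<open>w\<close> that never
  topples: \<open>count_growth\<close> along paths from \<open>w\<close> bounds all toppling counts.
  Run lengths are thus bounded, and a longest run must end in a stable configuration.\<close>

lemma stabilization_exists:
  assumes few: "2 * (\<Sum>u\<in>sg_verts m. \<eta> u) < card (sg_verts m)"
  shows "\<exists>vs \<eta>'. stabilization m \<eta> vs \<eta>'"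
proof -
  define N where "N = (\<Sum>u\<in>sg_verts m. \<eta> u)"
  \<comment> \<open>Paths have length at most \<open>2 * 2 ^ m\<close>, and each edge multiplies the
    bound by at most 10: 9 from the degree and 1 from the term \<open>N\<close>.\<close>
  define B where "B = N * 10 ^ (2 * 2 ^ m)"
  have count: "count_list vs y \<le> B" if run: "toppling_run m \<eta> vs \<eta>'" and y: "y \<in> sg_verts m" for vs \<eta>' y
  proof -
    have "card (set vs) < card (sg_verts m)" using card_toppled_le[OF run] few by simp
    then have "set vs \<noteq> sg_verts m" by auto
    then obtain w where w: "w \<in> sg_verts m" "w \<notin> set vs"
      using toppling_run_verts[OF run] by blast
    have c: "count_list vs z \<le> N * 10 ^ d" if "(w, z) \<in> sg_adj m ^^ d" for d z
      using that
    proof (induction d arbitrary: z)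
      case 0
      then show ?case using w by simp
    next
      case (Suc d)
      then obtain x where x: "(w, x) \<in> sg_adj m ^^ d" "z \<in> nbrs m x" by (auto simp: nbrs_def)
      have "count_list vs z \<le> N + 9 * (N * 10 ^ d)"
        using count_growth[OF run x(2)] Suc.IH[OF x(1)] unfolding N_def by linarith
      moreover have "N \<le> N * 10 ^ d" by simp
      ultimately have "count_list vs z \<le> 10 * (N * 10 ^ d)" by linarith
      then show ?case by (simp add: ac_simps)
    qed
    obtain d where "d \<le> 2 * 2 ^ m" "(w, y) \<in> sg_adj m ^^ d" using sg_path[OF w(1) y] by blast
    with c[of y d] have "count_list vs y \<le> N * 10 ^ d" by simp
    also have "\<dots> \<le> B" unfolding B_def
      using \<open>d \<le> 2 * 2 ^ m\<close> by (intro mult_left_mono power_increasing) auto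
    finally show ?thesis .
  qed
  have len: "length vs \<le> card (sg_verts m) * B" if run: "toppling_run m \<eta> vs \<eta>'" for vs \<eta>'
  proof -
    have "length vs = (\<Sum>y\<in>sg_verts m. count_list vs y)"
      using sum_count_set[OF toppling_run_verts[OF run] finite_sg_verts] by simp
    also have "\<dots> \<le> card (sg_verts m) * B"
      using sum_bounded_above[of "sg_verts m" "count_list vs" B] count[OF run] by simp
    finally show ?thesis .
  qed
  let ?P = "\<lambda>l. \<exists>vs \<eta>'. toppling_run m \<eta> vs \<eta>' \<and> length vs = l"
  have "?P 0" using toppling_run.Nil by blast
  moreover have "\<forall>l. ?P l \<longrightarrow> l \<le> card (sg_verts m) * B" using len by blast
  ultimately have "\<exists>l. ?P l \<and> (\<forall>l'. ?P l' \<longrightarrow> l' \<le> l)"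
    by (rule Nat.ex_has_greatest_nat)
  then obtain vs \<eta>' where max: "toppling_run m \<eta> vs \<eta>'"
    "\<And>vs' \<eta>''. toppling_run m \<eta> vs' \<eta>'' \<Longrightarrow> length vs' \<le> length vs" by blast
  have "stable m \<eta>'"
    unfolding stable_def
  proof (rule ballI, rule ccontr)
    fix v
    assume "v \<in> sg_verts m" "\<not> \<eta>' v < sg_deg m v"
    then have "toppling_run m \<eta>' [v] (topple m v \<eta>')"
      by (auto intro: toppling_run.intros)
    from max(2)[OF toppling_run_append[OF max(1) this]] show False by simp
  qed
  with max(1) show ?thesis by (auto simp: stabilization_def)
qed

section \<open>Barriers\<close>

text \<open>The condition of \<open>stabilizing\<close> at a vertex that initially holds no
  chips.\<close>

definition stable_at :: "nat \<Rightarrow> (vertex \<Rightarrow> nat) \<Rightarrow> vertex \<Rightarrow> bool" where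
  "stable_at m f x \<longleftrightarrow> (\<Sum>y\<in>nbrs m x. f y) < sg_deg m x * (f x + 1)"

text \<open>Corners are exempt: chips enter at the origin, and any corner may have further
  neighbours once the graph is embedded in a larger one.\<close>

definition inner_stable :: "nat \<Rightarrow> (vertex \<Rightarrow> nat) \<Rightarrow> bool" where
  "inner_stable k f \<longleftrightarrow> (\<forall>x\<in>sg_verts k - sg_corners k. stable_at k f x)"

text \<open>Fewer topplings of the neighbours mean fewer chips received, while \<open>x\<close>
  still sends out the same number. All gluing below rests on this.\<close>

lemma stable_at_mono:
  assumes "stable_at m g x" "G x = g x" "\<And>y. y \<in> nbrs m x \<Longrightarrow> G y \<le> g y"
  shows "stable_at m G x"
proof -
  have "(\<Sum>y\<in>nbrs m x. G y) \<le> (\<Sum>y\<in>nbrs m x. g y)" by (rule sum_mono) (rule assms(3))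
  with assms(1,2) show ?thesis by (simp add: stable_at_def)
qed

lemma stable_at_zero:
  "x \<in> sg_verts m \<Longrightarrow> (\<And>y. y \<in> nbrs m x \<Longrightarrow> G y = 0) \<Longrightarrow> stable_at m G x"
  by (simp add: stable_at_def sg_deg_pos)

lemma stable_at_image:
  assumes "inj_on \<phi> (nbrs k x)" "nbrs m (\<phi> x) = \<phi> ` nbrs k x"
  shows "stable_at m f (\<phi> x) \<longleftrightarrow> stable_at k (\<lambda>y. f (\<phi> y)) x"
  using assms by (simp add: stable_at_def sg_deg_nbrs sum.reindex card_image)

text \<open>Stability resembles superharmonicity: whichever function is smaller at \<open>x\<close>
  dominates the minimum at all neighbours.\<close>

lemma stable_at_min:
  assumes "stable_at m f x" "stable_at m g x"
  shows "stable_at m (\<lambda>y. min (f y) (g y)) x"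
proof (cases "f x \<le> g x")
  case True
  show ?thesis by (rule stable_at_mono[OF assms(1)]) (use True in simp_all)
next
  case False
  show ?thesis by (rule stable_at_mono[OF assms(2)]) (use False in simp_all)
qed

lemma nbrs_swap: "nbrs k (prod.swap x) = prod.swap ` nbrs k x"
proof (intro equalityI subsetI)
  fix y
  assume "y \<in> nbrs k (prod.swap x)"
  then have "prod.swap y \<in> nbrs k x"
    using swap_adj[of "prod.swap x" y k] by (simp add: nbrs_def)
  then show "y \<in> prod.swap ` nbrs k x" by (rule rev_image_eqI) simp
next
  fix y
  assume "y \<in> prod.swap ` nbrs k x"
  then obtain z where "z \<in> nbrs k x" "y = prod.swap z" ..
  then show "y \<in> nbrs k (prod.swap x)"
    using swap_adj[of x z k] by (simp add: nbrs_def)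
qed

lemma inner_stable_swap:
  assumes "inner_stable k f"
  shows "inner_stable k (\<lambda>x. f (prod.swap x))"
  unfolding inner_stable_def
proof
  fix x
  assume x: "x \<in> sg_verts k - sg_corners k"
  then have "prod.swap x \<in> sg_verts k - sg_corners k"
    using swap_verts[of x k] by (cases x) (auto simp: sg_corners_def)
  with assms have "stable_at k f (prod.swap x)" by (simp add: inner_stable_def)
  moreover have "inj_on prod.swap (nbrs k x)" by (rule inj_onI) (auto simp: prod_eq_iff)
  ultimately show "stable_at k (\<lambda>x. f (prod.swap x)) x"
    using stable_at_image[OF _ nbrs_swap] by blast
qed

lemma sg_corners_far: "sg_corners k = insert (0, 0) (far_corners k)"
  by (simp add: sg_corners_def far_corners_def)

lemma far_corners_verts: "far_corners k \<subseteq> sg_verts k"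
  by (simp add: far_corners_def)

lemma origin_notin_far [simp]: "(0, 0) \<notin> far_corners k"
  by (simp add: far_corners_def)

text \<open>A non-corner vertex of a copy has all its neighbours in that copy and is no corner of
  the larger graph. The same holds for the right and the top copy below.\<close>

lemma inner_stable_left:
  assumes "inner_stable (Suc k) f"
  shows "inner_stable k f"
  unfolding inner_stable_def
proof
  fix x
  assume x: "x \<in> sg_verts k - sg_corners k"
  then have n: "nbrs (Suc k) x = nbrs k x"
    by (intro nbrs_Suc_left) (auto simp: sg_corners_far)
  have "x \<notin> sg_corners (Suc k)"
    using x sg_verts_bound[of x k] by (auto simp: sg_corners_def)
  with x assms have "stable_at (Suc k) f x" by (simp add: inner_stable_def)
  with n show "stable_at k f x" by (simp add: stable_at_def sg_deg_nbrs)
qed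

lemma shift_right_corner:
  assumes "v \<in> sg_verts k" "shift (2 ^ k, 0) v \<in> sg_corners (Suc k)"
  shows "v = (2 ^ k, 0)"
  using assms by (auto simp: sg_corners_def shift_def prod_eq_iff)

lemma shift_top_corner:
  assumes "v \<in> sg_verts k" "shift (0, 2 ^ k) v \<in> sg_corners (Suc k)"
  shows "v = (0, 2 ^ k)"
  using assms by (auto simp: sg_corners_def shift_def prod_eq_iff)

lemma inj_on_shift: "inj_on (shift a) S"
  by (simp add: inj_on_def)

lemma stable_at_right:
  assumes "x \<in> sg_verts k" "x \<noteq> (0, 0)" "x \<noteq> (0, 2 ^ k)"
  shows "stable_at (Suc k) f (shift (2 ^ k, 0) x) \<longleftrightarrow> stable_at k (\<lambda>x. f (shift (2 ^ k, 0) x)) x"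
  by (rule stable_at_image[OF inj_on_shift nbrs_Suc_right[OF assms]])

lemma stable_at_top:
  assumes "x \<in> sg_verts k" "x \<noteq> (0, 0)" "x \<noteq> (2 ^ k, 0)"
  shows "stable_at (Suc k) f (shift (0, 2 ^ k) x) \<longleftrightarrow> stable_at k (\<lambda>x. f (shift (0, 2 ^ k) x)) x"
  by (rule stable_at_image[OF inj_on_shift nbrs_Suc_top[OF assms]])

lemma inner_stable_right:
  assumes "inner_stable (Suc k) f"
  shows "inner_stable k (\<lambda>x. f (shift (2 ^ k, 0) x))"
  unfolding inner_stable_def
proof
  fix x
  assume x: "x \<in> sg_verts k - sg_corners k"
  then have "shift (2 ^ k, 0) x \<notin> sg_corners (Suc k)"
    using shift_right_corner[of x k] by (auto simp: sg_corners_def)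
  with x assms have "stable_at (Suc k) f (shift (2 ^ k, 0) x)" by (simp add: inner_stable_def)
  with x show "stable_at k (\<lambda>x. f (shift (2 ^ k, 0) x)) x"
    by (simp add: stable_at_right sg_corners_def)
qed

lemma inner_stable_top:
  assumes "inner_stable (Suc k) f"
  shows "inner_stable k (\<lambda>x. f (shift (0, 2 ^ k) x))"
  unfolding inner_stable_def
proof
  fix x
  assume x: "x \<in> sg_verts k - sg_corners k"
  then have "shift (0, 2 ^ k) x \<notin> sg_corners (Suc k)"
    using shift_top_corner[of x k] by (auto simp: sg_corners_def)
  with x assms have "stable_at (Suc k) f (shift (0, 2 ^ k) x)" by (simp add: inner_stable_def)
  with x show "stable_at k (\<lambda>x. f (shift (0, 2 ^ k) x)) x"
    by (simp add: stable_at_top sg_corners_def)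
qed

text \<open>
  A barrier witnesses that \<open>t\<close> topplings of the origin do not carry chips to the far corners of
  the level \<open>k\<close> graph.
\<close>

definition barrier :: "nat \<Rightarrow> nat \<Rightarrow> (vertex \<Rightarrow> nat) \<Rightarrow> bool" where
  "barrier k t h \<longleftrightarrow> inner_stable k h \<and> t \<le> h (0, 0)
     \<and> (\<forall>y\<in>far_corners k. h y = 0 \<and> (\<forall>x\<in>nbrs k y. h x = 0))"

section \<open>Extending and gluing barriers\<close>

text \<open>A barrier vanishes at the far corners and at their neighbours, so not even these corners
  receive a chip. Vertices beyond them see only zeros.\<close>

lemma barrier_extend:
  assumes h: "barrier k t h" and supp: "\<And>x. x \<notin> sg_verts k \<Longrightarrow> h x = 0"
  shows "barrier (Suc k) t h"
proof -
  have far: "h y = 0" "\<And>x. x \<in> nbrs k y \<Longrightarrow> h x = 0" if "y \<in> far_corners k" for y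
    using h that by (auto simp: barrier_def)
  have pos: "y \<in> sg_verts k" "nbrs (Suc k) y = nbrs k y" if "h y \<noteq> 0" for y
  proof -
    show y: "y \<in> sg_verts k" using that supp[of y] by metis
    have "y \<notin> far_corners k" using that far(1)[of y] by metis
    with y show "nbrs (Suc k) y = nbrs k y" by (rule nbrs_Suc_left)
  qed
  have zero: "h y = 0" if "y \<in> nbrs (Suc k) x" "x \<notin> sg_verts k \<or> x \<in> far_corners k" for x y
  proof (rule ccontr)
    assume y: "h y \<noteq> 0"
    then have xy: "x \<in> nbrs k y" using that(1) nbrs_sym[of x "Suc k" y] pos(2)[OF y] by simp
    then have "x \<in> far_corners k" using that(2) nbrs_subset[of k y] by blast
    moreover have "y \<in> nbrs k x" using xy nbrs_sym[of x k y] by simp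
    ultimately show False using far(2)[of x y] y by blast
  qed
  have out: "x \<notin> sg_verts k" if "x \<in> far_corners (Suc k)" for x
    using that sg_verts_bound[of x k] by (auto simp: far_corners_def)
  have "stable_at (Suc k) h x" if x: "x \<in> sg_verts (Suc k) - sg_corners (Suc k)" for x
  proof (cases "x \<notin> sg_verts k \<or> x \<in> far_corners k")
    case True
    then show ?thesis using x zero by (intro stable_at_zero) auto
  next
    case False
    then have "x \<notin> sg_corners k" using x by (auto simp: sg_corners_far)
    then have "stable_at k h x" using h False by (auto simp: barrier_def inner_stable_def)
    then show ?thesis using nbrs_Suc_left False by (simp add: stable_at_def sg_deg_nbrs)
  qed
  moreover have "h y = 0 \<and> (\<forall>x\<in>nbrs (Suc k) y. h x = 0)" if "y \<in> far_corners (Suc k)" for y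
    using out[OF that] supp[of y] zero[of _ y] by simp
  ultimately show ?thesis using h by (simp add: barrier_def inner_stable_def)
qed

lemma stable_at_cong:
  assumes "x \<in> sg_verts k" "\<And>y. y \<in> sg_verts k \<Longrightarrow> f y = g y"
  shows "stable_at k f x = stable_at k g x"
proof -
  have "(\<Sum>y\<in>nbrs k x. f y) = (\<Sum>y\<in>nbrs k x. g y)"
    using assms(2) nbrs_subset[of k x] by (intro sum.cong) auto
  then show ?thesis using assms by (simp add: stable_at_def)
qed

lemma barrier_restrict:
  assumes "barrier k t h"
  shows "barrier k t (\<lambda>x. if x \<in> sg_verts k then h x else 0)" (is "barrier k t ?h")
proof -
  have "stable_at k ?h x = stable_at k h x" if "x \<in> sg_verts k" for x
    using that by (rule stable_at_cong) simp
  with assms show ?thesis by (simp add: barrier_def inner_stable_def)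
qed

text \<open>The support is recorded because it later confines the toppled vertices to the level
  \<open>k\<close> gaskets at the source.\<close>

lemma barrier_extend_level:
  assumes "barrier k t h" "k \<le> j"
  shows "\<exists>h'. barrier j t h' \<and> (\<forall>x. h' x \<noteq> 0 \<longrightarrow> x \<in> sg_verts k)"
proof -
  let ?h = "\<lambda>x. if x \<in> sg_verts k then h x else 0"
  have "barrier j t ?h"
    using assms(2)
  proof (induction rule: dec_induct)
    case base
    show ?case by (rule barrier_restrict[OF assms(1)])
  next
    case (step i)
    have "sg_verts k \<subseteq> sg_verts i" using step(1) by (rule sg_verts_mono)
    then show ?case by (intro barrier_extend[OF step.IH]) auto
  qed
  then show ?thesis by (intro exI[of _ ?h]) auto
qed

text \<open>
  Cap a function that is invariant under the reflection by a barrier on the two copies away from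
  the origin; symmetry makes the same barrier work at both entrances.
\<close>

lemma barrier_glue:
  assumes g: "inner_stable (Suc k) g" "t \<le> g (0, 0)"
    and p: "g (2 ^ k, 0) = p" "g (0, 2 ^ k) = p"
    and h: "barrier k p h"
  shows "\<exists>G. barrier (Suc k) t G"
proof -
  let ?b = "(2 ^ k, 0) :: vertex" and ?c = "(0, 2 ^ k) :: vertex"
  \<comment> \<open>\<open>THE\<close> recovers the coordinates within the right or top copy.
    \<open>G_b\<close> and \<open>G_c\<close> show that a single formula describes \<open>G\<close>
    on each of these copies, shared corners included.\<close>
  define G where "G x = (if x \<in> sg_verts k then g x
    else if \<exists>v\<in>sg_verts k. x = shift ?b v then min (g x) (h (THE v. x = shift ?b v))
    else min (g x) (h (THE v. x = shift ?c v)))" for x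
  have hfar: "h y = 0" "\<And>x. x \<in> nbrs k y \<Longrightarrow> h x = 0" if "y \<in> far_corners k" for y
    using h that by (auto simp: barrier_def)
  have far: "?b \<in> far_corners k" "?c \<in> far_corners k" by (simp_all add: far_corners_def)
  have G_le: "G x \<le> g x" for x by (simp add: G_def)
  have G_left: "G x = g x" if "x \<in> sg_verts k" for x using that by (simp add: G_def)
  have the: "(THE v. shift a u = shift a v) = u" for a u :: vertex by auto
  have hp: "p \<le> h (0, 0)" using h by (simp add: barrier_def)
  \<comment> \<open>At the entrance the cap is inactive because \<open>p \<le> h (0, 0)\<close>, so
    the clauses agree on the corner shared with the left copy.\<close>
  have G_b: "G (shift ?b v) = min (g (shift ?b v)) (h v)" if v: "v \<in> sg_verts k" for v
  proof (cases "v = (0, 0)")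
    case True
    then show ?thesis using hp p G_left[of ?b] by simp
  next
    case False
    then have "shift ?b v \<notin> sg_verts k" using v shift_right_in_left by blast
    with v show ?thesis by (auto simp: G_def the)
  qed
  have G_c: "G (shift ?c v) = min (g (shift ?c v)) (h v)" if v: "v \<in> sg_verts k" for v
  proof -
    consider "v = (0, 0)" | "v = ?b" | "v \<noteq> (0, 0)" "v \<noteq> ?b" by blast
    then show ?thesis
    proof cases
      case 1
      then show ?thesis using hp p G_left[of ?c] by simp
    next
      case 2
      \<comment> \<open>At the corner shared by the right and top copies both caps are zero, as it
        is a far corner of each.\<close>
      then have "shift ?c v = shift ?b ?c" by (simp add: shift_def)
      with G_b[of ?c] hfar(1) far 2 show ?thesis by simp
    next
      case 3
      then have "shift ?c v \<notin> sg_verts k" "\<not> (\<exists>u\<in>sg_verts k. shift ?c v = shift ?b u)"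
        using v shift_top_in_left shift_right_eq_top by metis+
      then show ?thesis by (simp add: G_def the)
    qed
  qed
  have G_bh: "G (shift ?b v) \<le> h v" and G_ch: "G (shift ?c v) \<le> h v" if "v \<in> sg_verts k" for v
    using that G_b G_c by auto
  have h_stable: "stable_at k h v" if "v \<in> sg_verts k" "v \<notin> sg_corners k" for v
    using h that by (simp add: barrier_def inner_stable_def)
  have g_stable: "stable_at (Suc k) g x" if "x \<in> sg_verts (Suc k)" "x \<notin> sg_corners (Suc k)" for x
    using g that by (simp add: inner_stable_def)
  have b_zero: "G y = 0" if "y \<in> shift ?b ` nbrs k z" "z \<in> far_corners k" for y z
    using that G_bh hfar(2)[of z] nbrs_subset by fastforce
  have c_zero: "G y = 0" if "y \<in> shift ?c ` nbrs k z" "z \<in> far_corners k" for y z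
    using that G_ch hfar(2)[of z] nbrs_subset by fastforce
  have junction: "G y = 0" if "y \<in> nbrs (Suc k) (2 ^ k, 2 ^ k)" for y
  proof -
    have "y \<in> shift ?b ` nbrs k ?c \<or> y \<in> shift ?c ` nbrs k ?b"
      using that unfolding nbrs_Suc_junction by simp
    then show ?thesis using b_zero[OF _ far(2)] c_zero[OF _ far(1)] by metis
  qed
  have "stable_at (Suc k) G x" if x: "x \<in> sg_verts (Suc k)" "x \<notin> sg_corners (Suc k)" for x
  proof -
    consider "x \<in> sg_verts k" | "x = (2 ^ k, 2 ^ k)"
      | v where "v \<in> sg_verts k" "v \<noteq> (0, 0)" "v \<noteq> ?c" "x = shift ?b v"
      | v where "v \<in> sg_verts k" "v \<noteq> (0, 0)" "v \<noteq> ?b" "x = shift ?c v"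
    proof (cases "x \<in> sg_verts k \<or> x = (2 ^ k, 2 ^ k)")
      case True
      then show ?thesis using that by blast
    next
      case False
      with x consider v where "v \<in> sg_verts k" "x = shift ?b v" | v where "v \<in> sg_verts k" "x = shift ?c v"
        by auto
      then show ?thesis
      proof cases
        case (1 v)
        have "v \<noteq> (0, 0)" "v \<noteq> ?c" using False 1(2) junction_eq(1)[of k] by auto
        with 1 that(3) show ?thesis by blast
      next
        case (2 v)
        have "v \<noteq> (0, 0)" "v \<noteq> ?b" using False 2(2) junction_eq(2)[of k] by auto
        with 2 that(4) show ?thesis by blast
      qed
    qed
    then show ?thesis
    proof cases
      case 1
      \<comment> \<open>This includes the two entrances, whose neighbours lie in two copies:
        \<open>g\<close> is stable there, and \<open>G\<close> keeps the value of \<open>g\<close>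
        at \<open>x\<close> and is nowhere larger.\<close>
      show ?thesis
        by (rule stable_at_mono[OF g_stable[OF x] G_left[OF 1] G_le])
    next
      case 2
      then show ?thesis using x junction by (intro stable_at_zero) auto
    next
      case (3 v)
      show ?thesis
      \<comment> \<open>Either \<open>g\<close> or the transported \<open>h\<close> attains the
        minimum at \<open>x\<close>, and that function dominates \<open>G\<close> at the
        neighbours.\<close>
      proof (cases "g x \<le> h v")
        case True
        then have "G x = g x" using G_b[OF 3(1)] 3(4) by simp
        then show ?thesis by (rule stable_at_mono[OF g_stable[OF x] _ G_le])
      next
        case False
        have "v \<noteq> ?b" using x(2) 3(4) by (auto simp: sg_corners_def shift_def)
        then have "stable_at k h v" using 3 h_stable by (simp add: sg_corners_def)
        then have "stable_at k (\<lambda>y. G (shift ?b y)) v"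
        proof (rule stable_at_mono)
          show "G (shift ?b v) = h v" using False G_b[OF 3(1)] 3(4) by simp
          show "G (shift ?b y) \<le> h y" if "y \<in> nbrs k v" for y
            using that nbrs_subset[of k v] by (intro G_bh) blast
        qed
        then show ?thesis
          unfolding 3(4) stable_at_right[OF 3(1-3)] .
      qed
    next
      case (4 v)
      show ?thesis
      proof (cases "g x \<le> h v")
        case True
        then have "G x = g x" using G_c[OF 4(1)] 4(4) by simp
        then show ?thesis by (rule stable_at_mono[OF g_stable[OF x] _ G_le])
      next
        case False
        have "v \<noteq> ?c" using x(2) 4(4) by (auto simp: sg_corners_def shift_def)
        then have "stable_at k h v" using 4 h_stable by (simp add: sg_corners_def)
        then have "stable_at k (\<lambda>y. G (shift ?c y)) v"
        proof (rule stable_at_mono)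
          show "G (shift ?c v) = h v" using False G_c[OF 4(1)] 4(4) by simp
          show "G (shift ?c y) \<le> h y" if "y \<in> nbrs k v" for y
            using that nbrs_subset[of k v] by (intro G_ch) blast
        qed
        then show ?thesis
          unfolding 4(4) stable_at_top[OF 4(1-3)] .
      qed
    qed
  qed
  moreover have "t \<le> G (0, 0)" using g(2) G_left by simp
  moreover have "G y = 0 \<and> (\<forall>x\<in>nbrs (Suc k) y. G x = 0)" if "y \<in> far_corners (Suc k)" for y
  proof -
    from that consider "y = shift ?b ?b" | "y = shift ?c ?c"
      by (auto simp: far_corners_def shift_def)
    then show ?thesis
    proof cases
      case 1
      have "nbrs (Suc k) y = shift ?b ` nbrs k ?b" unfolding 1 by (rule nbrs_Suc_right) auto
      moreover have "G y = 0" using G_b[of ?b] hfar(1) far 1 by simp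
      ultimately show ?thesis using b_zero[OF _ far(1)] by simp
    next
      case 2
      have "nbrs (Suc k) y = shift ?c ` nbrs k ?c" unfolding 2 by (rule nbrs_Suc_top) auto
      moreover have "G y = 0" using G_c[of ?c] hfar(1) far 2 by simp
      ultimately show ?thesis using c_zero[OF _ far(2)] by simp
    qed
  qed
  ultimately have "barrier (Suc k) t G" unfolding barrier_def inner_stable_def by blast
  then show ?thesis by blast
qed

text \<open>Induction on the level. A barrier for \<open>t\<close> on the left copy would extend to
  the whole graph, so the left copy fills up. A barrier for the value at the entrances of the other
  copies could be glued on, so these fill up as well.\<close>

lemma no_barrier_fills:
  "\<nexists>h. barrier k t h \<Longrightarrow> inner_stable k f \<Longrightarrow> t \<le> f (0, 0) \<Longrightarrow> x \<in> lower_left k \<Longrightarrow> 0 < f x"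
proof (induction k arbitrary: t f x)
  case 0
  \<comment> \<open>At level 0 all vertices are corners, so the zero function is a barrier for
    \<open>t = 0\<close>. Hence \<open>t\<close> is positive and the origin topples.\<close>
  have "barrier 0 0 (\<lambda>_. 0)" by (auto simp: barrier_def inner_stable_def sg_corners_def)
  with 0(1) have "t \<noteq> 0" by metis
  with 0 show ?case by simp
next
  case (Suc k)
  let ?b = "(2 ^ k, 0) :: vertex" and ?c = "(0, 2 ^ k) :: vertex"
  \<comment> \<open>Symmetrizing makes the values at both entrances equal, as
    \<open>barrier_glue\<close> requires. Since \<open>f\<close> is at least \<open>?g\<close>, the
    common value also bounds \<open>f\<close> from below at both.\<close>
  let ?g = "\<lambda>x. min (f x) (f (prod.swap x))"
  have A: "\<nexists>h. barrier k t h"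
    using Suc.prems(1) barrier_extend_level[of k t _ "Suc k"] by auto
  have g: "inner_stable (Suc k) ?g"
    using Suc.prems(2) inner_stable_swap[OF Suc.prems(2)]
    by (simp add: inner_stable_def stable_at_min)
  have p: "?g ?c = ?g ?b" by (simp add: min.commute)
  have B: "\<nexists>h. barrier k (?g ?b) h"
    using barrier_glue[OF g _ refl p, of t] Suc.prems(1,3) by auto
  from Suc.prems(4) consider "x \<in> lower_left k" | v where "v \<in> lower_left k" "x = shift ?b v"
    | v where "v \<in> lower_left k" "x = shift ?c v" by auto
  then show ?case
  proof cases
    case 1
    then show ?thesis using Suc.IH[OF A inner_stable_left[OF Suc.prems(2)] Suc.prems(3)] by blast
  next
    case 2
    then show ?thesis using Suc.IH[OF B inner_stable_right[OF Suc.prems(2)]] by simp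
  next
    case 3
    then show ?thesis using Suc.IH[OF B inner_stable_top[OF Suc.prems(2)]] by simp
  qed
qed

section \<open>Confinement of the odometer\<close>

lemma mirror_corner:
  "mirror k (0, 0) = (2 ^ k, 0)" "mirror k (2 ^ k, 0) = (0, 0)" "mirror k (0, 2 ^ k) = (0, 2 ^ k)"
  by (simp_all add: mirror_def)

lemma nbrs_mirror:
  assumes "x \<in> sg_verts k"
  shows "nbrs k (mirror k x) = mirror k ` nbrs k x"
proof (intro equalityI subsetI)
  fix y
  assume y: "y \<in> nbrs k (mirror k x)"
  then have "mirror k y \<in> nbrs k x"
    using mirror_adj[of "mirror k x" y k] mirror_mirror[OF assms] by (simp add: nbrs_def)
  moreover have "y = mirror k (mirror k y)"
    using y nbrs_subset[of k "mirror k x"] mirror_mirror by (metis subsetD)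
  ultimately show "y \<in> mirror k ` nbrs k x" by (rule rev_image_eqI)
next
  fix y
  assume "y \<in> mirror k ` nbrs k x"
  then obtain z where "z \<in> nbrs k x" "y = mirror k z" ..
  then show "y \<in> nbrs k (mirror k x)"
    using mirror_adj[of x z k] by (simp add: nbrs_def)
qed

lemma stable_at_mirror:
  assumes "x \<in> sg_verts k"
  shows "stable_at k f (mirror k x) \<longleftrightarrow> stable_at k (\<lambda>x. f (mirror k x)) x"
proof (rule stable_at_image[OF _ nbrs_mirror[OF assms]])
  show "inj_on (mirror k) (nbrs k x)"
    using mirror_mirror nbrs_subset[of k x] by (intro inj_on_inverseI[of _ "mirror k"]) blast
qed

lemma sg_verts_Suc_cases:
  assumes "x \<in> sg_verts (Suc k)"
  obtains "x \<in> sg_verts k" | v where "v \<in> sg_verts k" "x = shift (2 ^ k, 0) v"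
    | v where "v \<in> sg_verts k" "x = shift (0, 2 ^ k) v"
  using assms by auto

text \<open>Seen from the source \<open>(2 ^ j, 0)\<close>, each bottom copy is a level
  \<open>j\<close> gasket entered at a corner: the right one by translation, the left one by
  reflection. The barrier depends only on the value at the source, so one barrier caps both; the top
  copy gets zero.\<close>

lemma two_sided_cap:
  assumes f: "\<And>x. x \<in> sg_verts (Suc j) \<Longrightarrow> x \<noteq> (2 ^ j, 0) \<Longrightarrow> stable_at (Suc j) f x"
    and h: "barrier j (f (2 ^ j, 0)) h"
  obtains G where "\<And>x. G x \<le> f x" "G (2 ^ j, 0) = f (2 ^ j, 0)"
    "\<And>x. x \<in> sg_verts (Suc j) \<Longrightarrow> x \<noteq> (2 ^ j, 0) \<Longrightarrow> stable_at (Suc j) G x"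
    "\<And>x y. x \<in> sg_top_copy (Suc j) \<union> sg_corners (Suc j) \<Longrightarrow> y \<in> nbrs (Suc j) x \<Longrightarrow> G y = 0"
    "\<And>x. G x \<noteq> 0 \<Longrightarrow> \<exists>v. h v \<noteq> 0 \<and> (x = shift (2 ^ j, 0) v \<or> x = mirror j v)"
proof -
  let ?b = "(2 ^ j, 0) :: vertex" and ?c = "(0, 2 ^ j) :: vertex"
  define G where "G x = (if x \<in> sg_verts j then min (f x) (h (mirror j x))
    else if \<exists>v\<in>sg_verts j. x = shift ?b v then min (f x) (h (THE v. x = shift ?b v))
    else 0)" for x
  have hfar: "h y = 0" "\<And>x. x \<in> nbrs j y \<Longrightarrow> h x = 0" if "y \<in> far_corners j" for y
    using h that by (auto simp: barrier_def)
  have far: "?b \<in> far_corners j" "?c \<in> far_corners j" by (simp_all add: far_corners_def)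
  have hp: "f ?b \<le> h (0, 0)" using h by (simp add: barrier_def)
  have the: "(THE v. shift a u = shift a v) = u" for a u :: vertex by auto
  have G_le: "G x \<le> f x" for x by (simp add: G_def)
  have G_a: "G (mirror j v) = min (f (mirror j v)) (h v)" if "v \<in> sg_verts j" for v
    using that by (simp add: G_def mirror_verts mirror_mirror)
  have G_origin: "G ?b = f ?b"
    using G_a[of "(0, 0)"] hp by (simp add: mirror_corner)
  have G_b: "G (shift ?b v) = min (f (shift ?b v)) (h v)" if v: "v \<in> sg_verts j" for v
  proof (cases "v = (0, 0)")
    case True
    then show ?thesis using hp G_origin by simp
  next
    case False
    then have "shift ?b v \<notin> sg_verts j" using v shift_right_in_left by metis
    with v show ?thesis by (auto simp: G_def the)
  qed
  \<comment> \<open>The top copy meets the bottom copies only where the caps vanish, so the value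
    zero is consistent there.\<close>
  have G_c: "G (shift ?c v) = 0" if v: "v \<in> sg_verts j" for v
  proof -
    consider "v = (0, 0)" | "v = ?b" | "v \<noteq> (0, 0)" "v \<noteq> ?b" by metis
    then show ?thesis
    proof cases
      case 1
      then show ?thesis using G_a[of ?c] hfar(1)[OF far(2)] by (simp add: mirror_corner)
    next
      case 2
      then have "shift ?c v = shift ?b ?c" by (simp add: shift_def)
      with G_b[of ?c] hfar(1)[OF far(2)] show ?thesis by simp
    next
      case 3
      then have "shift ?c v \<notin> sg_verts j" "\<not> (\<exists>u\<in>sg_verts j. shift ?c v = shift ?b u)"
        using v shift_top_in_left shift_right_eq_top by metis+
      then show ?thesis by (simp add: G_def)
    qed
  qed
  have a_zero: "G y = 0" if y: "y \<in> nbrs j (mirror j z)" and z: "z \<in> far_corners j" for y z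
  proof -
    have "z \<in> sg_verts j" using z far_corners_verts by blast
    then obtain w where w: "w \<in> nbrs j z" "y = mirror j w"
      using y unfolding nbrs_mirror[OF \<open>z \<in> sg_verts j\<close>] by blast
    have "w \<in> sg_verts j" using w(1) nbrs_subset by blast
    from G_a[OF this] show ?thesis using hfar(2)[OF z w(1)] w(2) by simp
  qed
  have b_zero: "G y = 0" if "y \<in> shift ?b ` nbrs j z" "z \<in> far_corners j" for y z
    using that G_b hfar(2)[of z] nbrs_subset by fastforce
  have c_zero: "G y = 0" if "y \<in> shift ?c ` nbrs j z" for y z
    using that G_c nbrs_subset by fastforce
  \<comment> \<open>This corner belongs to the left and the top copy. Its neighbours in either must
    be controlled, and an inclusion suffices for that.\<close>
  have left_top: "nbrs (Suc j) ?c \<subseteq> nbrs j ?c \<union> shift ?c ` nbrs j (0, 0)"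
  proof
    fix y
    assume "y \<in> nbrs (Suc j) ?c"
    then have "(?c, y) \<in> sg_adj (Suc j)" by (simp add: nbrs_def)
    then consider "(?c, y) \<in> sg_adj j"
      | u where "?c = shift ?b u" | u v where "?c = shift ?c u" "y = shift ?c v" "(u, v) \<in> sg_adj j"
      unfolding sg_adj_Suc_iff by blast
    then show "y \<in> nbrs j ?c \<union> shift ?c ` nbrs j (0, 0)"
    proof cases
      case 1
      then show ?thesis by (simp add: nbrs_def)
    next
      case (2 u)
      then show ?thesis by (simp add: shift_def)
    next
      case (3 u v)
      then have "u = (0, 0)" by (simp add: shift_def prod_eq_iff)
      with 3 show ?thesis by (auto simp: nbrs_def)
    qed
  qed
  have zero: "G y = 0"
    if x: "x \<in> sg_top_copy (Suc j) \<union> sg_corners (Suc j)" and y: "y \<in> nbrs (Suc j) x" for x y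
  proof -
    from x consider v where "v \<in> sg_verts j" "x = shift ?c v" | "x = (0, 0)" | "x = shift ?b ?b"
      by (auto simp: sg_top_copy_def sg_corners_def shift_def)
    then show ?thesis
    proof cases
      case (1 v)
      consider "v = (0, 0)" | "v = ?b" | "v \<noteq> (0, 0)" "v \<noteq> ?b" by metis
      then show ?thesis
      proof cases
        case v: 1
        then have "y \<in> nbrs j (mirror j ?c) \<union> shift ?c ` nbrs j (0, 0)"
          using y 1 left_top by (auto simp: mirror_corner)
        then show ?thesis
        proof
          assume "y \<in> nbrs j (mirror j ?c)"
          then show ?thesis by (rule a_zero[OF _ far(2)])
        qed (rule c_zero)
      next
        case v: 2
        then have "y \<in> shift ?b ` nbrs j ?c \<union> shift ?c ` nbrs j ?b"
          using y 1 by (simp add: junction_eq nbrs_Suc_junction)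
        then show ?thesis
        proof
          assume "y \<in> shift ?b ` nbrs j ?c"
          then show ?thesis by (rule b_zero[OF _ far(2)])
        qed (rule c_zero)
      next
        case v: 3
        have "y \<in> shift ?c ` nbrs j v"
          using y unfolding 1(2) nbrs_Suc_top[OF 1(1) v] .
        then show ?thesis by (rule c_zero)
      qed
    next
      case 2
      have "nbrs (Suc j) (0, 0) = nbrs j (0, 0)" by (rule nbrs_Suc_left) auto
      then have "y \<in> nbrs j (mirror j ?b)" using y 2 by (simp add: mirror_corner)
      then show ?thesis by (rule a_zero[OF _ far(1)])
    next
      case 3
      have "nbrs (Suc j) (shift ?b ?b) = shift ?b ` nbrs j ?b" by (rule nbrs_Suc_right) auto
      then have "y \<in> shift ?b ` nbrs j ?b" using y 3 by simp
      then show ?thesis by (rule b_zero[OF _ far(1)])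
    qed
  qed
  have h_stable: "stable_at j h v" if "v \<in> sg_verts j" "v \<notin> sg_corners j" for v
    using h that by (simp add: barrier_def inner_stable_def)
  have "stable_at (Suc j) G x" if x: "x \<in> sg_verts (Suc j)" "x \<noteq> ?b" for x
  proof (cases "x \<in> sg_top_copy (Suc j) \<union> sg_corners (Suc j)")
    case True
    show ?thesis by (rule stable_at_zero[OF x(1) zero[OF True]])
  next
    case out: False
    have notop: "x \<noteq> shift ?c v" if "v \<in> sg_verts j" for v
      using that out by (auto simp: sg_top_copy_def)
    show ?thesis
      using x(1)
    proof (cases rule: sg_verts_Suc_cases)
      case 1
      have nc: "x \<noteq> ?c" using notop[of "(0, 0)"] by simp
      define v where "v = mirror j x"
      have v: "v \<in> sg_verts j" "x = mirror j v"
        using 1 mirror_verts mirror_mirror by (auto simp: v_def)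
      show ?thesis
      proof (cases "f x \<le> h v")
        case True
        then have "G x = f x" using G_a[OF v(1)] v(2) by simp
        then show ?thesis by (rule stable_at_mono[OF f[OF x] _ G_le])
      next
        case False
        have "v \<notin> sg_corners j"
          using v(2) x(2) nc out by (auto simp: sg_corners_def mirror_corner)
        then have "stable_at j h v" using v h_stable by simp
        then have "stable_at j (\<lambda>y. G (mirror j y)) v"
        proof (rule stable_at_mono)
          show "G (mirror j v) = h v" using False G_a[OF v(1)] v(2) by simp
          show "G (mirror j y) \<le> h y" if "y \<in> nbrs j v" for y
            using that nbrs_subset[of j v] G_a[of y] by auto
        qed
        then have "stable_at j G x" using stable_at_mirror[OF v(1)] v(2) by simp
        moreover have "nbrs (Suc j) x = nbrs j x"
          using 1 nc x(2) by (intro nbrs_Suc_left) (auto simp: far_corners_def)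
        ultimately show ?thesis by (simp add: stable_at_def sg_deg_nbrs)
      qed
    next
      case (2 v)
      have v: "v \<noteq> (0, 0)" "v \<noteq> ?c" "v \<noteq> ?b"
        using 2 x(2) notop[of ?b] junction_eq[of j] out by (auto simp: sg_corners_def shift_def)
      show ?thesis
      proof (cases "f x \<le> h v")
        case True
        then have "G x = f x" using G_b[OF 2(1)] 2(2) by simp
        then show ?thesis by (rule stable_at_mono[OF f[OF x] _ G_le])
      next
        case False
        have "stable_at j h v" using v 2 h_stable by (simp add: sg_corners_def)
        then have "stable_at j (\<lambda>y. G (shift ?b y)) v"
        proof (rule stable_at_mono)
          show "G (shift ?b v) = h v" using False G_b[OF 2(1)] 2(2) by simp
          show "G (shift ?b y) \<le> h y" if "y \<in> nbrs j v" for y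
            using that nbrs_subset[of j v] G_b[of y] by auto
        qed
        then show ?thesis unfolding 2(2) stable_at_right[OF 2(1) v(1,2)] .
      qed
    next
      case (3 v)
      then show ?thesis using notop by blast
    qed
  qed
  moreover have "\<exists>v. h v \<noteq> 0 \<and> (x = shift ?b v \<or> x = mirror j v)" if x: "G x \<noteq> 0" for x
  proof (cases "x \<in> sg_verts j")
    case True
    then have "h (mirror j x) \<noteq> 0" "x = mirror j (mirror j x)"
      using x by (auto simp: G_def mirror_mirror)
    then show ?thesis by blast
  next
    case False
    with x obtain v where v: "v \<in> sg_verts j" "x = shift ?b v"
      unfolding G_def by metis
    with x have "h v \<noteq> 0" using G_b[OF v(1)] by auto
    with v show ?thesis by blast
  qed
  ultimately show ?thesis using that[of G] G_le G_origin zero by blast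
qed

lemma sg_v0_Suc: "sg_v0 (Suc j) = (2 ^ j, 0)"
  by (simp add: sg_v0_def)

lemma v0_verts: "(2 ^ j, 0) \<in> sg_verts (Suc j)"
  by simp

lemma stabilizing_point:
  "stabilizing (Suc j) (point_config (Suc j) n) f \<longleftrightarrow>
     (\<forall>x\<in>sg_verts (Suc j). x \<noteq> (2 ^ j, 0) \<longrightarrow> stable_at (Suc j) f x) \<and>
     n + (\<Sum>y\<in>nbrs (Suc j) (2 ^ j, 0). f y) < sg_deg (Suc j) (2 ^ j, 0) * (f (2 ^ j, 0) + 1)"
  unfolding stabilizing_def stable_at_def point_config_def sg_v0_Suc using v0_verts[of j] by auto

lemma point_config_total: "(\<Sum>u\<in>sg_verts (Suc j). point_config (Suc j) n u) = n"
  using v0_verts[of j] finite_sg_verts[of "Suc j"] by (simp add: point_config_def sg_v0_Suc sum.delta)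

section \<open>Confinement and independence of the order\<close>

text \<open>Without a barrier, \<open>no_barrier_fills\<close> makes \<open>3 ^ k\<close> vertices
  of the right bottom copy topple, more than the \<open>2 * n\<close> allowed by
  \<open>card_toppled_le\<close>.\<close>

lemma barrier_exists:
  assumes stab: "stabilization (Suc j) (point_config (Suc j) n) vs \<eta>"
    and k: "k \<le> j" "2 * n < 3 ^ k"
  shows "\<exists>h. barrier k (count_list vs (2 ^ j, 0)) h"
proof (rule ccontr)
  let ?b = "(2 ^ j, 0) :: vertex"
  assume no: "\<nexists>h. barrier k (count_list vs ?b) h"
  let ?f = "\<lambda>x. count_list vs (shift ?b x)"
  have "stabilizing (Suc j) (point_config (Suc j) n) (count_list vs)"
    using stab by (rule stabilization_stabilizing)
  then have f: "stable_at (Suc j) (count_list vs) x" if "x \<in> sg_verts (Suc j)" "x \<noteq> ?b" for x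
    using that by (simp add: stabilizing_point)
  have "inner_stable j ?f"
    unfolding inner_stable_def
  proof
    fix x
    assume x: "x \<in> sg_verts j - sg_corners j"
    then have "shift ?b x \<in> sg_verts (Suc j)" "shift ?b x \<noteq> ?b"
      by (auto simp: sg_corners_def shift_def prod_eq_iff)
    from f[OF this] x show "stable_at j ?f x" by (simp add: stable_at_right sg_corners_def)
  qed
  \<comment> \<open>Descends from level \<open>j\<close> to level \<open>k\<close>: the level
    \<open>k\<close> gasket at the source is the nested left copy in the coordinates of the right
    bottom copy.\<close>
  with k(1) have fk: "inner_stable k ?f"
    by (induction rule: inc_induct) (blast intro: inner_stable_left)+
  have "0 < ?f x" if "x \<in> lower_left k" for x
    using no_barrier_fills[OF no fk _ that] by simp
  then have "shift ?b ` lower_left k \<subseteq> set vs"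
    using count_notin by force
  then have "card (shift ?b ` lower_left k) \<le> card (set vs)" by (rule card_mono[rotated]) simp
  also have "\<dots> \<le> 2 * n"
    using card_toppled_le[of "Suc j" "point_config (Suc j) n" vs \<eta>] stab
    by (simp add: stabilization_def point_config_total del: sg_verts.simps)
  finally show False using k(2) by (simp add: card_image inj_on_shift card_lower_left)
qed

lemma capped_odometer:
  assumes stab: "stabilization (Suc j) (point_config (Suc j) n) vs \<eta>"
    and k: "k \<le> j" "2 * n < 3 ^ k"
  obtains G where "stabilizing (Suc j) (point_config (Suc j) n) G"
    "\<And>x y. x \<in> sg_top_copy (Suc j) \<union> sg_corners (Suc j) \<Longrightarrow> y \<in> nbrs (Suc j) x \<Longrightarrow> G y = 0"
    "\<And>x. G x \<noteq> 0 \<Longrightarrow> x \<in> shift (2 ^ j, 0) ` sg_verts k \<union> mirror j ` sg_verts k"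
proof -
  let ?b = "(2 ^ j, 0) :: vertex"
  have f: "stabilizing (Suc j) (point_config (Suc j) n) (count_list vs)"
    using stab by (rule stabilization_stabilizing)
  obtain h where h: "barrier j (count_list vs ?b) h" "\<And>x. h x \<noteq> 0 \<Longrightarrow> x \<in> sg_verts k"
    using barrier_exists[OF stab k] barrier_extend_level[OF _ k(1)] by metis
  have st: "stable_at (Suc j) (count_list vs) x" if "x \<in> sg_verts (Suc j)" "x \<noteq> ?b" for x
    using that f by (simp add: stabilizing_point)
  show thesis
  proof (rule two_sided_cap[OF st h(1)])
    fix G
    assume G: "\<And>x. G x \<le> count_list vs x" "G ?b = count_list vs ?b"
      "\<And>x. x \<in> sg_verts (Suc j) \<Longrightarrow> x \<noteq> ?b \<Longrightarrow> stable_at (Suc j) G x"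
      "\<And>x y. x \<in> sg_top_copy (Suc j) \<union> sg_corners (Suc j) \<Longrightarrow> y \<in> nbrs (Suc j) x \<Longrightarrow> G y = 0"
      "\<And>x. G x \<noteq> 0 \<Longrightarrow> \<exists>v. h v \<noteq> 0 \<and> (x = shift ?b v \<or> x = mirror j v)"
    show thesis
    proof (rule that)
      \<comment> \<open>At the source, the cap keeps the value and only lowers the neighbours, so
        the inequality involving \<open>n\<close> survives.\<close>
      have "(\<Sum>y\<in>nbrs (Suc j) ?b. G y) \<le> (\<Sum>y\<in>nbrs (Suc j) ?b. count_list vs y)"
        by (rule sum_mono) (rule G(1))
      then have "n + (\<Sum>y\<in>nbrs (Suc j) ?b. G y) < sg_deg (Suc j) ?b * (G ?b + 1)"
        using f unfolding stabilizing_point G(2) by linarith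
      then show "stabilizing (Suc j) (point_config (Suc j) n) G"
        using G(3) unfolding stabilizing_point by blast
      show "x \<in> shift ?b ` sg_verts k \<union> mirror j ` sg_verts k" if nz: "G x \<noteq> 0" for x
      proof -
        obtain v where v: "h v \<noteq> 0" "x = shift ?b v \<or> x = mirror j v"
          using G(5)[OF nz] by metis
        from h(2)[OF v(1)] v(2) show ?thesis by auto
      qed
    qed (rule G(4))
  qed
qed

text \<open>By least action the odometer lies below its own capped version, so it inherits the
  support of the cap.\<close>

lemma toppled_confined:
  assumes stab: "stabilization (Suc j) (point_config (Suc j) n) vs \<eta>"
    and k: "k \<le> j" "2 * n < 3 ^ k"
  shows "set vs \<subseteq> shift (2 ^ j, 0) ` sg_verts k \<union> mirror j ` sg_verts k"
proof
  fix x
  assume "x \<in> set vs"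
  then have "count_list vs x \<noteq> 0" by (simp add: count_list_0_iff)
  obtain G where G: "stabilizing (Suc j) (point_config (Suc j) n) G"
    "\<And>x. G x \<noteq> 0 \<Longrightarrow> x \<in> shift (2 ^ j, 0) ` sg_verts k \<union> mirror j ` sg_verts k"
    using capped_odometer[OF stab k] by metis
  have "count_list vs x \<le> G x"
    using stab least_action[OF _ G(1)] unfolding stabilization_def by blast
  with \<open>count_list vs x \<noteq> 0\<close> show "x \<in> shift (2 ^ j, 0) ` sg_verts k \<union> mirror j ` sg_verts k"
    by (intro G(2)) simp
qed

text \<open>A stabilization exists because the graph has more than \<open>2 * n\<close> vertices.
  Its cap bounds the counts of every run, complete or not, so no neighbour of the top copy or of a
  corner ever topples.\<close>

lemma large_enough_Suc:
  assumes n: "2 * n < 3 ^ j"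
  shows "large_enough (Suc j) n"
proof -
  have "3 ^ Suc j \<le> card (sg_verts (Suc j))"
    using card_mono[OF finite_sg_verts lower_left_subset, of "Suc j"] by (simp only: card_lower_left)
  then have "2 * (\<Sum>u\<in>sg_verts (Suc j). point_config (Suc j) n u) < card (sg_verts (Suc j))"
    using n by (simp only: point_config_total) simp
  then obtain ws \<zeta> where ws: "stabilization (Suc j) (point_config (Suc j) n) ws \<zeta>"
    using stabilization_exists by blast
  obtain G where G: "stabilizing (Suc j) (point_config (Suc j) n) G"
    "\<And>x y. x \<in> sg_top_copy (Suc j) \<union> sg_corners (Suc j) \<Longrightarrow> y \<in> nbrs (Suc j) x \<Longrightarrow> G y = 0"
    using capped_odometer[OF ws order_refl n] by metis
  have "\<eta> v = 0" if run: "toppling_run (Suc j) (point_config (Suc j) n) vs \<eta>"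
    and v: "v \<in> sg_top_copy (Suc j) \<union> sg_corners (Suc j)" for vs \<eta> v
  proof -
    have "v \<noteq> (2 ^ j, 0)"
      using v by (auto simp: sg_top_copy_def sg_corners_def shift_def)
    then have "point_config (Suc j) n v = 0" by (simp add: point_config_def sg_v0_Suc)
    moreover have "(\<Sum>y\<in>nbrs (Suc j) v. count_list vs y) = 0"
      using G(2)[OF v] least_action[OF run G(1)] by (intro sum.neutral) (metis le_zero_eq)
    ultimately show ?thesis using toppling_run_balance[OF run, of v] by simp
  qed
  with ws show ?thesis by (auto simp: large_enough_def)
qed

text \<open>Each of two stabilizing odometers bounds the other by least action, so they
  coincide.\<close>

lemma toppled_eq:
  assumes "stabilization m (point_config m n) vs \<eta>"
  shows "toppled m n = set vs"
proof -
  have "set ws = set vs" if ws: "stabilization m (point_config m n) ws \<zeta>" for ws \<zeta>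
  proof -
    have "count_list ws x \<le> count_list vs x" "count_list vs x \<le> count_list ws x" for x
      using ws assms least_action stabilization_stabilizing unfolding stabilization_def by metis+
    then have "count_list ws x = count_list vs x" for x by (simp add: le_antisym)
    then show ?thesis by (metis count_list_0_iff subset_antisym subsetI)
  qed
  with assms show ?thesis unfolding toppled_def by blast
qed

section \<open>Growth of the diameter\<close>

lemma path_from_v0:
  assumes k: "k \<le> j" and x: "x \<in> shift (2 ^ j, 0) ` sg_verts k \<union> mirror j ` sg_verts k"
  shows "\<exists>d\<le>2 ^ k. ((2 ^ j, 0), x) \<in> sg_adj (Suc j) ^^ d"
  using x
proof
  assume "x \<in> shift (2 ^ j, 0) ` sg_verts k"
  then obtain v where v: "v \<in> sg_verts k" "x = shift (2 ^ j, 0) v" ..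
  obtain d where d: "d \<le> 2 ^ k" "((0, 0), v) \<in> sg_adj k ^^ d"
    using sg_path_from_origin[OF v(1)] by blast
  have "(shift (2 ^ j, 0) (0, 0), shift (2 ^ j, 0) v) \<in> sg_adj (Suc j) ^^ d"
  proof (rule relpow_map[OF _ d(2)])
    fix a b
    assume "(a, b) \<in> sg_adj k"
    then have "(a, b) \<in> sg_adj j" using sg_adj_mono[OF k] by blast
    then show "(shift (2 ^ j, 0) a, shift (2 ^ j, 0) b) \<in> sg_adj (Suc j)"
      unfolding sg_adj_Suc_iff by blast
  qed
  with d(1) show ?thesis unfolding v(2) by (intro exI[of _ d]) simp
next
  assume "x \<in> mirror j ` sg_verts k"
  then obtain v where v: "v \<in> sg_verts k" "x = mirror j v" ..
  obtain d where d: "d \<le> 2 ^ k" "((0, 0), v) \<in> sg_adj k ^^ d"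
    using sg_path_from_origin[OF v(1)] by blast
  have "(mirror j (0, 0), mirror j v) \<in> sg_adj (Suc j) ^^ d"
  proof (rule relpow_map[OF _ d(2)])
    fix a b
    assume "(a, b) \<in> sg_adj k"
    then have "(a, b) \<in> sg_adj j" using sg_adj_mono[OF k] by blast
    from mirror_adj[OF this] show "(mirror j a, mirror j b) \<in> sg_adj (Suc j)"
      unfolding sg_adj_Suc_iff by blast
  qed
  with d(1) show ?thesis unfolding v(2) by (intro exI[of _ d]) (simp add: mirror_corner)
qed

lemma large_enough_Suc_level: "large_enough m n \<Longrightarrow> \<exists>j. m = Suc j"
  unfolding large_enough_def by (elim conjE, cases m) simp_all

lemma toppled_dist_le:
  assumes le: "large_enough m n" and k: "2 * n < 3 ^ k"
    and uw: "u \<in> toppled m n" "w \<in> toppled m n"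
  shows "sg_dist m u w \<le> 2 * 2 ^ k"
proof -
  obtain vs \<eta> where st: "stabilization m (point_config m n) vs \<eta>"
    using le unfolding large_enough_def by blast
  obtain j where j: "m = Suc j" using large_enough_Suc_level[OF le] ..
  have T: "toppled m n = set vs" by (rule toppled_eq[OF st])
  show ?thesis
  proof (cases "k \<le> j")
    case True
    have sub: "set vs \<subseteq> shift (2 ^ j, 0) ` sg_verts k \<union> mirror j ` sg_verts k"
      using st True k unfolding j by (rule toppled_confined)
    obtain d where d: "d \<le> 2 ^ k" "((2 ^ j, 0), u) \<in> sg_adj m ^^ d"
      using path_from_v0[OF True subsetD[OF sub uw(1)[unfolded T]]] unfolding j by blast
    obtain e where e: "e \<le> 2 ^ k" "((2 ^ j, 0), w) \<in> sg_adj m ^^ e"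
      using path_from_v0[OF True subsetD[OF sub uw(2)[unfolded T]]] unfolding j by blast
    have "(u, (2 ^ j, 0)) \<in> sg_adj m ^^ d"
      using d(2) by (rule symD[OF relpow_sym[OF sym_sg_adj]])
    then have "(u, w) \<in> sg_adj m ^^ (d + e)" using e(2) unfolding relpow_add by (rule relcompI)
    then have "sg_dist m u w \<le> d + e" by (rule sg_dist_le)
    then show ?thesis using d(1) e(1) by linarith
  next
    case False
    \<comment> \<open>\<open>large_enough\<close> does not force \<open>k \<le> j\<close>. Otherwise
      \<open>m \<le> k\<close>, and the diameter bound for the whole graph suffices.\<close>
    have "set vs \<subseteq> sg_verts m"
      using st toppling_run_verts unfolding stabilization_def by blast
    then have "sg_dist m u w \<le> 2 * 2 ^ m" using uw unfolding T by (intro sg_dist_bound) blast+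
    also have "(2::nat) ^ m \<le> 2 ^ k" using False j by (intro power_increasing) auto
    finally show ?thesis by simp
  qed
qed

text \<open>A vertex holding 9 chips is never stable, since degrees are at most 9. In particular the
  maximum over the toppled vertices is over a nonempty set.\<close>

lemma v0_toppled:
  assumes le: "large_enough m n" and n: "9 \<le> n"
  shows "sg_v0 m \<in> toppled m n"
proof -
  obtain vs \<eta> where st: "stabilization m (point_config m n) vs \<eta>"
    using le unfolding large_enough_def by blast
  obtain j where j: "m = Suc j" using large_enough_Suc_level[OF le] ..
  have v0: "sg_v0 m \<in> sg_verts m" unfolding j sg_v0_Suc by (rule v0_verts)
  have "sg_v0 m \<in> set vs"
  proof (rule ccontr)
    assume "sg_v0 m \<notin> set vs"
    then have "n \<le> \<eta> (sg_v0 m)"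
      using st toppling_run_balance[of m "point_config m n" vs \<eta> "sg_v0 m"]
      by (simp add: stabilization_def point_config_def)
    moreover have "\<eta> (sg_v0 m) < sg_deg m (sg_v0 m)"
      using st v0 by (simp add: stabilization_def stable_def)
    ultimately show False using n sg_deg_le[of m "sg_v0 m"] by simp
  qed
  then show ?thesis by (simp add: toppled_eq[OF st])
qed

section \<open>Counting the chips near the source\<close>

text \<open>A chip ends at the source or next to a toppled vertex, hence in one of two small gaskets
  at the source, where stability bounds the chips per vertex.\<close>

lemma chips_le_of_dist:
  assumes le: "large_enough m n"
    and D: "\<And>v. v \<in> toppled m n \<Longrightarrow> sg_dist m (sg_v0 m) v < 2 ^ k"
  shows "n \<le> 54 * 3 ^ k"
proof -
  obtain vs \<eta> where st: "stabilization m (point_config m n) vs \<eta>"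
    using le unfolding large_enough_def by blast
  obtain j where j: "m = Suc j" using large_enough_Suc_level[OF le] ..
  let ?b = "(2 ^ j, 0) :: vertex"
  have run: "toppling_run m (point_config m n) vs \<eta>" using st by (simp add: stabilization_def)
  define i where "i = min k j"
  define S where "S = shift ?b ` sg_verts i \<union> mirror j ` sg_verts i"
  have finS: "finite S" by (simp add: S_def finite_sg_verts)
  have out: "\<eta> x = 0" if x: "x \<in> sg_verts m" "x \<notin> S" for x
  proof (rule ccontr)
    assume nz: "\<eta> x \<noteq> 0"
    have "\<forall>v\<in>sg_top_copy m \<union> sg_corners m. \<eta> v = 0"
      using le run unfolding large_enough_def by (meson UnCI)
    with nz have "x \<notin> sg_top_copy m" by auto
    then have "x \<notin> shift (0, 2 ^ j) ` sg_verts j" by (simp add: j sg_top_copy_def)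
    with x(1) have cases: "x \<in> sg_verts j \<or> x \<in> shift ?b ` sg_verts j" by (auto simp: j)
    have "x \<in> S"
    proof (cases "k \<le> j")
      case True
      have "(?b, x) \<in> sg_adj m ^^ (if x = ?b then 0 else 1) \<or> (\<exists>y\<in>set vs. (y, x) \<in> sg_adj m)"
      proof (cases "x = ?b")
        case False
        then have "point_config m n x = 0" by (simp add: point_config_def j sg_v0_Suc)
        then have "(\<Sum>y\<in>nbrs m x. count_list vs y) \<noteq> 0"
          using toppling_run_balance[OF run, of x] nz by simp
        then obtain y where y: "y \<in> nbrs m x" "count_list vs y \<noteq> 0"
          by (meson sum.neutral)
        then have "y \<in> set vs" by (metis count_notin)
        moreover have "(y, x) \<in> sg_adj m" using y(1) nbrs_sym[of y m x] by (simp add: nbrs_def)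
        ultimately show ?thesis by blast
      qed simp
      then have "\<exists>d\<le>2 ^ k. (?b, x) \<in> sg_adj m ^^ d"
      proof
        assume "(?b, x) \<in> sg_adj m ^^ (if x = ?b then 0 else 1)"
        moreover have "(if x = ?b then 0 else 1) \<le> (2::nat) ^ k" by simp
        ultimately show ?thesis by blast
      next
        assume "\<exists>y\<in>set vs. (y, x) \<in> sg_adj m"
        then obtain y where y: "y \<in> set vs" "(y, x) \<in> sg_adj m" ..
        have "y \<in> toppled m n" using y(1) toppled_eq[OF st] by simp
        from D[OF this] have "sg_dist m ?b y < 2 ^ k" by (simp only: j sg_v0_Suc)
        moreover have "(?b, y) \<in> sg_adj m ^^ sg_dist m ?b y"
          using sg_adj_verts[OF y(2)] v0_verts[of j] unfolding j by (intro sg_dist_path) auto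
        then have "(?b, x) \<in> sg_adj m ^^ Suc (sg_dist m ?b y)" using y(2) by auto
        \<comment> \<open>The strict inequality in the hypothesis leaves room for the extra edge
          from the toppled vertex to \<open>x\<close>.\<close>
        ultimately show ?thesis by (intro exI[of _ "Suc (sg_dist m ?b y)"]) auto
      qed
      then obtain d where d: "d \<le> 2 ^ k" "(?b, x) \<in> sg_adj m ^^ d" by blast
      from sg_path_step[OF d(2)] d(1)
      have box: "2 ^ j \<le> fst x + 2 ^ k" "fst x + snd x \<le> 2 ^ j + 2 ^ k" by auto
      have i: "i = k" using True by (simp add: i_def)
      show ?thesis
        using cases
      proof
        assume xj: "x \<in> sg_verts j"
        have "mirror j x \<in> sg_verts k"
        proof (rule sg_verts_low[OF mirror_verts[OF xj] True])
          show "fst (mirror j x) + snd (mirror j x) \<le> 2 ^ k"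
            using box(1) sg_verts_bound[OF xj] by (simp add: mirror_def)
        qed
        then show ?thesis
          unfolding S_def i using mirror_mirror[OF xj] by (metis UnI2 image_eqI)
      next
        assume "x \<in> shift ?b ` sg_verts j"
        then obtain v where v: "v \<in> sg_verts j" "x = shift ?b v" ..
        have "v \<in> sg_verts k"
          by (rule sg_verts_low[OF v(1) True]) (use box(2) v(2) in \<open>simp add: shift_def\<close>)
        then show ?thesis unfolding S_def i v(2) by blast
      qed
    next
      case False
      then have i: "i = j" by (simp add: i_def)
      show ?thesis
        using cases
      proof
        assume xj: "x \<in> sg_verts j"
        then show ?thesis
          unfolding S_def i using mirror_mirror[OF xj] mirror_verts[OF xj] by (metis UnI2 image_eqI)
      qed (simp add: S_def i)
    qed
    with x(2) show False by blast
  qed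
  have "n = (\<Sum>x\<in>sg_verts m. \<eta> x)"
    using toppling_run_total[OF run] unfolding j point_config_total by simp
  also have "\<dots> = (\<Sum>x\<in>sg_verts m \<inter> S. \<eta> x)"
    by (rule sum.mono_neutral_right) (use finite_sg_verts out in blast)+
  \<comment> \<open>The constant 54 is the product of 9 chips per vertex, 2 gaskets, and the factor
    3 of \<open>card_sg_verts_le\<close>.\<close>
  also have "\<dots> \<le> (\<Sum>x\<in>sg_verts m \<inter> S. 9)"
  proof (rule sum_mono)
    fix x
    assume "x \<in> sg_verts m \<inter> S"
    then have "\<eta> x < sg_deg m x" using st by (simp add: stabilization_def stable_def)
    then show "\<eta> x \<le> 9" using sg_deg_le[of m x] by linarith
  qed
  also have "\<dots> = 9 * card (sg_verts m \<inter> S)" by simp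
  also have "card (sg_verts m \<inter> S) \<le> card S" using finS by (intro card_mono) auto
  also have "card S \<le> card (shift ?b ` sg_verts i) + card (mirror j ` sg_verts i)"
    unfolding S_def by (rule card_Un_le)
  also have "\<dots> \<le> 2 * card (sg_verts i)"
    using card_image_le[OF finite_sg_verts, of "shift ?b" i]
      card_image_le[OF finite_sg_verts, of "mirror j" i] by linarith
  also have "card (sg_verts i) \<le> 3 * 3 ^ i" by (rule card_sg_verts_le)
  also have "(3::nat) ^ i \<le> 3 ^ k" by (simp add: i_def)
  finally show ?thesis by simp
qed

section \<open>The exponent and the two bounds\<close>

lemma D_f_pos: "0 < D_f"
  by (simp add: D_f_def)

lemma two_powr_D_f: "real (2 ^ k) powr D_f = real (3 ^ k)"
proof -
  have "real (2 ^ k) powr D_f = exp (D_f * ln (2 ^ k))" by (simp add: powr_def)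
  also have "\<dots> = exp (real k * ln 3)" by (simp add: D_f_def ln_realpow)
  also have "\<dots> = real (3 ^ k)" by (simp add: exp_of_nat_mult)
  finally show ?thesis .
qed

lemma three_powr_D_f: "real (3 ^ k) powr (1 / D_f) = real (2 ^ k)"
  unfolding two_powr_D_f[symmetric] using D_f_pos by (simp add: powr_powr)

text \<open>Selects the scale at which a growing power first exceeds a given quantity.\<close>

lemma least_power_bound:
  assumes "\<not> P 0" "\<exists>k. P k"
  obtains k where "P (Suc k)" "\<not> P k"
proof -
  from assms(2) obtain n where "P n" ..
  from ex_least_nat_less[OF this assms(1)] show ?thesis using that by blast
qed

definition toppled_diam :: "nat \<Rightarrow> nat \<Rightarrow> nat" where
  "toppled_diam m n = Max {sg_dist m u v | u v. u \<in> toppled m n \<and> v \<in> toppled m n}"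

lemma finite_toppled_dists:
  "finite {sg_dist m u v | u v. u \<in> toppled m n \<and> v \<in> toppled m n}"
proof -
  have "toppled m n \<subseteq> sg_verts m"
    using toppling_run_verts by (fastforce simp: toppled_def stabilization_def)
  then have "finite (toppled m n)" using finite_sg_verts by (rule finite_subset)
  then have "finite ((\<lambda>(u, v). sg_dist m u v) ` (toppled m n \<times> toppled m n))" by simp
  then show ?thesis by (rule rev_finite_subset) auto
qed

lemma toppled_diam_upper:
  assumes le: "large_enough m n" and n: "9 \<le> n"
  shows "real (toppled_diam m n) \<le> 4 * 2 powr (1 / D_f) * real n powr (1 / D_f)"
proof -
  have "\<not> 2 * n < 3 ^ 0" using n by simp
  moreover have "\<exists>k. 2 * n < 3 ^ k"
    by (rule exI[of _ "2 * n"]) (rule less_exp[THEN less_le_trans], simp add: power_mono)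
  \<comment> \<open>Now \<open>3 ^ k \<le> 2 * n < 3 ^ Suc k\<close>: the upper inequality confines
    the topplings, the lower one compares \<open>2 ^ k\<close> with the power of
    \<open>n\<close>.\<close>
  ultimately obtain k where k: "2 * n < 3 ^ Suc k" "\<not> 2 * n < 3 ^ k"
    by (rule least_power_bound)
  have "toppled_diam m n \<le> 2 * 2 ^ Suc k"
    unfolding toppled_diam_def
  proof (rule Max.boundedI[OF finite_toppled_dists])
    show "{sg_dist m u v | u v. u \<in> toppled m n \<and> v \<in> toppled m n} \<noteq> {}"
      using v0_toppled[OF le n] by blast
    show "d \<le> 2 * 2 ^ Suc k" if "d \<in> {sg_dist m u v | u v. u \<in> toppled m n \<and> v \<in> toppled m n}" for d
      using that toppled_dist_le[OF le k(1)] by blast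
  qed
  then have "real (toppled_diam m n) \<le> real (2 * 2 ^ Suc k)" by (simp only: of_nat_le_iff)
  then have "real (toppled_diam m n) \<le> 4 * real (2 ^ k)" by simp
  also have "real (2 ^ k) = real (3 ^ k) powr (1 / D_f)" by (rule three_powr_D_f[symmetric])
  also have "\<dots> \<le> real (2 * n) powr (1 / D_f)"
    using k(2) D_f_pos by (intro powr_mono2) (simp_all only: of_nat_le_iff not_less, simp_all)
  also have "\<dots> = 2 powr (1 / D_f) * real n powr (1 / D_f)" by (simp add: powr_mult)
  finally show ?thesis by simp
qed

lemma toppled_diam_lower:
  assumes le: "large_enough m n" and n: "54 < n"
  shows "real n powr (1 / D_f) \<le> 162 powr (1 / D_f) * real (toppled_diam m n)"
proof -
  have v0: "sg_v0 m \<in> toppled m n" by (rule v0_toppled[OF le]) (use n in simp)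
  let ?D = "toppled_diam m n"
  have dist: "sg_dist m (sg_v0 m) v \<le> ?D" if "v \<in> toppled m n" for v
    unfolding toppled_diam_def using that v0 by (intro Max_ge[OF finite_toppled_dists]) blast
  have chips: "n \<le> 54 * 3 ^ k" if "?D < 2 ^ k" for k
    using chips_le_of_dist[OF le, of k] dist that le_less_trans by blast
  \<comment> \<open>A diameter of zero would give \<open>n \<le> 54\<close>; this is where the
    threshold on \<open>n\<close> comes from.\<close>
  have "\<not> ?D < 2 ^ 0" using chips[of 0] n by auto
  moreover have "\<exists>k. ?D < 2 ^ k" using less_exp by blast
  ultimately obtain k where k: "?D < 2 ^ Suc k" "\<not> ?D < 2 ^ k"
    by (rule least_power_bound)
  have "n \<le> 162 * 3 ^ k" using chips[OF k(1)] by simp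
  then have "real n \<le> real (162 * 3 ^ k)" by (simp only: of_nat_le_iff)
  then have "real n powr (1 / D_f) \<le> real (162 * 3 ^ k) powr (1 / D_f)"
    using D_f_pos by (intro powr_mono2) auto
  also have "\<dots> = 162 powr (1 / D_f) * real (3 ^ k) powr (1 / D_f)" by (simp add: powr_mult)
  also have "\<dots> = 162 powr (1 / D_f) * real (2 ^ k)" by (simp only: three_powr_D_f)
  also have "real (2 ^ k) \<le> real ?D" using k(2) by (simp only: of_nat_le_iff not_less)
  finally show ?thesis by (simp add: mult_left_mono)
qed

lemma eventually_large_enough: "\<exists>M. \<forall>m\<ge>M. large_enough m n"
proof (intro exI allI impI)
  fix m
  \<comment> \<open>The crude choice \<open>Suc (2 * n)\<close> for the bound \<open>M\<close> works
    because \<open>2 * n < 2 ^ (2 * n)\<close>.\<close>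
  assume m: "Suc (2 * n) \<le> m"
  then obtain j where j: "m = Suc j" by (cases m) auto
  have "2 * n < 2 ^ (2 * n)" by (rule less_exp)
  also have "\<dots> \<le> (2::nat) ^ j" using m j by (intro power_increasing) auto
  also have "\<dots> \<le> 3 ^ j" by (rule power_mono) auto
  finally show "large_enough m n" unfolding j by (rule large_enough_Suc)
qed

theorem corollary7:
  shows "(\<forall>n\<ge>1. \<exists>M. \<forall>m\<ge>M. large_enough m n) \<and>
    (\<forall>m :: nat \<Rightarrow> nat. (\<forall>n\<ge>1. large_enough (m n) n) \<longrightarrow>
      (\<lambda>n. real (Max {sg_dist (m n) u v | u v. u \<in> toppled (m n) n \<and> v \<in> toppled (m n) n}))
        \<in> \<Theta>(\<lambda>n. real n powr (1 / D_f)))"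
  unfolding toppled_diam_def[symmetric]
proof (intro conjI allI impI)
  fix n :: nat
  show "\<exists>M. \<forall>m\<ge>M. large_enough m n" by (rule eventually_large_enough)
next
  fix m :: "nat \<Rightarrow> nat"
  assume le: "\<forall>n\<ge>1. large_enough (m n) n"
  show "(\<lambda>n. real (toppled_diam (m n) n)) \<in> \<Theta>(\<lambda>n. real n powr (1 / D_f))"
  proof (rule bigthetaI)
    show "(\<lambda>n. real (toppled_diam (m n) n)) \<in> O(\<lambda>n. real n powr (1 / D_f))"
    proof (rule bigoI)
      show "eventually (\<lambda>n. norm (real (toppled_diam (m n) n))
          \<le> 4 * 2 powr (1 / D_f) * norm (real n powr (1 / D_f))) at_top"
        \<comment> \<open>The same threshold serves both bounds, which require
          \<open>9 \<le> n\<close> and \<open>54 < n\<close>.\<close>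
        using eventually_ge_at_top[of 55]
      proof eventually_elim
        case (elim n)
        then show ?case using toppled_diam_upper[of "m n" n] le by simp
      qed
    qed
    show "(\<lambda>n. real (toppled_diam (m n) n)) \<in> \<Omega>(\<lambda>n. real n powr (1 / D_f))"
      unfolding bigomega_iff_bigo
    proof (rule bigoI)
      show "eventually (\<lambda>n. norm (real n powr (1 / D_f))
          \<le> 162 powr (1 / D_f) * norm (real (toppled_diam (m n) n))) at_top"
        using eventually_ge_at_top[of 55]
      proof eventually_elim
        case (elim n)
        then show ?case using toppled_diam_lower[of "m n" n] le by simp
      qed
    qed
  qed
qed

end
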